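(* Let $m$ be a locally summable weight on a simplicial complex $\Sigma$. If $m$ is uniformly positive, i.e. $\inf_{\tau\in\Sigma}m(\tau)>0$, and the Forman curvature $c^H/m$ is bounded from below on $\Sigma$, then $\Delta^\circ_c$ is essentially self-adjoint for all $\circ\in\{+,-,H\}$.
   Context: Simplicial complex: $V$ is a countable set and $\hat\Sigma$ is a collection of finite subsets of $V$ closed under taking subsets. $\dim\tau=|\tau|-1$, $\hat\Sigma_k=\{\tau\in\hat\Sigma:\dim\tau=k\}$. A weight is a function $m:\hat\Sigma\to(0,\infty)$. Put $\Sigma=\hat\Sigma$ if $\sum_{v\in\hat\Sigma_0}m(v)<\infty$, and $\Sigma=\hat\Sigma\setminus\{\varnothing\}$ otherwise. For $\tau,\sigma\in\Sigma$, $\tau\prec\sigma$ (equivalently $\sigma\succ\tau$) means $\tau\subset\sigma$ and $|\sigma\setminus\tau|=1$. All sums are over elements of $\Sigma$. The weight is locally summable if $\sum_{\sigma\succ\tau}m(\sigma)<\infty$ for all $\tau\in\Sigma$. Functions: $F=\mathbb{R}^{\Sigma}$; $F^c$ is the subspace of finitely supported functions; $F^1=\{\omega\in F:\sum_{\sigma\succ\tau}m(\sigma)|\omega(\sigma)|<\infty\text{ for all }\tau\in\Sigma\}$; $\ell^2=\ell^2(\Sigma,m)=\{\omega\in F:\sum_\Sigma m\omega^2<\infty\}$ with its natural inner product. Coboundary operator: a linear map $\delta:F\to F$ with $\delta\delta=0$ such that $\theta(\tau,\sigma):=\delta 1_\tau(\sigma)\in\{-1,0,1\}$, $\theta(\tau,\sigma)\neq0$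 iff $\tau\prec\sigma$, and $\delta\omega(\sigma)=\sum_{\tau\prec\sigma}\omega(\tau)\theta(\tau,\sigma)$. Boundary operator: $\partial:F^1\to F$, $\partial\omega(\rho)=\frac1{m(\rho)}\sum_{\tau\succ\rho}m(\tau)\omega(\tau)\theta(\rho,\tau)$. $\Delta^+_c$, $\Delta^-_c$, $\Delta^H_c$ are the operators in $\ell^2$ with domain $F^c$ acting as $\partial\delta$, $\delta\partial$, $(\delta+\partial)^2=\partial\delta+\delta\partial$, respectively (in the situation of the statement these map $F^c$ into $\ell^2$). Forman curvature: the function $c^H/m$ on $\Sigma$, where $$c^H(\tau)=\sum_{\rho\prec\tau}\frac{m(\tau)^2}{m(\rho)}+\sum_{\sigma\succ\tau}m(\sigma)-\sum_{\rho\prec\tau}\ \sum_{\tau'\succ\rho,\,\tau'\neq\tau}\Big|\frac{m(\tau)m(\tau')}{m(\rho)}-\sum_{\sigma:\,\tau,\tau'\prec\sigma}m(\sigma)\Big|.$$ *)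

theory Defs
  imports "HOL-Analysis.Analysis"
begin

section \<open>Weighted simplicial complexes\<close>

definition abstract_simplicial_complex :: "'v set \<Rightarrow> 'v set set \<Rightarrow> bool" where
  "abstract_simplicial_complex V K \<longleftrightarrow>
     countable V \<and> (\<forall>\<tau>\<in>K. finite \<tau> \<and> \<tau> \<subseteq> V) \<and> (\<forall>\<tau>\<in>K. \<forall>\<rho>. \<rho> \<subseteq> \<tau> \<longrightarrow> \<rho> \<in> K)"

definition simplex_dim :: "'v set \<Rightarrow> int" where
  "simplex_dim \<tau> = int (card \<tau>) - 1"

definition simplices_of_dim :: "'v set set \<Rightarrow> int \<Rightarrow> 'v set set" where
  "simplices_of_dim K k = {\<tau>\<in>K. simplex_dim \<tau> = k}"

definition is_weight :: "'v set set \<Rightarrow> ('v set \<Rightarrow> real) \<Rightarrow> bool" where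
  "is_weight K m \<longleftrightarrow> (\<forall>\<tau>\<in>K. m \<tau> > 0)"

text \<open>The empty simplex is retained exactly if the vertices have finite total weight.\<close>

definition effective_complex :: "'v set set \<Rightarrow> ('v set \<Rightarrow> real) \<Rightarrow> 'v set set" where
  "effective_complex K m =
     (if m summable_on simplices_of_dim K 0 then K else K - {{}})"

definition covered_by :: "'v set \<Rightarrow> 'v set \<Rightarrow> bool" where
  "covered_by \<tau> \<sigma> \<longleftrightarrow> \<tau> \<subseteq> \<sigma> \<and> card (\<sigma> - \<tau>) = 1"

definition faces_below :: "'v set set \<Rightarrow> 'v set \<Rightarrow> 'v set set" where
  "faces_below S \<tau> = {\<rho>\<in>S. covered_by \<rho> \<tau>}"

definition cofaces_above :: "'v set set \<Rightarrow> 'v set \<Rightarrow> 'v set set" where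
  "cofaces_above S \<tau> = {\<sigma>\<in>S. covered_by \<tau> \<sigma>}"

definition locally_summable :: "'v set set \<Rightarrow> ('v set \<Rightarrow> real) \<Rightarrow> bool" where
  "locally_summable S m \<longleftrightarrow> (\<forall>\<tau>\<in>S. m summable_on cofaces_above S \<tau>)"

text \<open>The infimum is taken in the extended reals, so that it is \<open>\<infinity>\<close> if \<open>S\<close> is empty.\<close>

definition uniformly_positive :: "'v set set \<Rightarrow> ('v set \<Rightarrow> real) \<Rightarrow> bool" where
  "uniformly_positive S m \<longleftrightarrow> (INF \<tau>\<in>S. ereal (m \<tau>)) > 0"


section \<open>Function spaces\<close>

text \<open>
  A real function on \<open>S\<close> is represented by its extension by zero to all sets.
\<close>

definition cochains :: "'v set set \<Rightarrow> ('v set \<Rightarrow> real) set" where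
  "cochains S = {\<omega>. \<forall>\<sigma>. \<sigma> \<notin> S \<longrightarrow> \<omega> \<sigma> = 0}"

definition finite_cochains :: "'v set set \<Rightarrow> ('v set \<Rightarrow> real) set" where
  "finite_cochains S = {\<omega>\<in>cochains S. finite {\<sigma>. \<omega> \<sigma> \<noteq> 0}}"

definition summable_cochains :: "'v set set \<Rightarrow> ('v set \<Rightarrow> real) \<Rightarrow> ('v set \<Rightarrow> real) set" where
  "summable_cochains S m =
     {\<omega>\<in>cochains S. \<forall>\<tau>\<in>S. (\<lambda>\<sigma>. m \<sigma> * \<bar>\<omega> \<sigma>\<bar>) summable_on cofaces_above S \<tau>}"

definition l2_cochains :: "'v set set \<Rightarrow> ('v set \<Rightarrow> real) \<Rightarrow> ('v set \<Rightarrow> real) set" where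
  "l2_cochains S m = {\<omega>\<in>cochains S. (\<lambda>\<sigma>. m \<sigma> * (\<omega> \<sigma>)\<^sup>2) summable_on S}"

definition l2_inner :: "'v set set \<Rightarrow> ('v set \<Rightarrow> real) \<Rightarrow> ('v set \<Rightarrow> real) \<Rightarrow> ('v set \<Rightarrow> real) \<Rightarrow> real" where
  "l2_inner S m \<omega> \<eta> = (\<Sum>\<^sub>\<infinity>\<sigma>\<in>S. m \<sigma> * \<omega> \<sigma> * \<eta> \<sigma>)"

definition l2_norm :: "'v set set \<Rightarrow> ('v set \<Rightarrow> real) \<Rightarrow> ('v set \<Rightarrow> real) \<Rightarrow> real" where
  "l2_norm S m \<omega> = sqrt (l2_inner S m \<omega> \<omega>)"


section \<open>Coboundary, boundary and Laplacians\<close>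

definition incidence ::
    "(('v set \<Rightarrow> real) \<Rightarrow> ('v set \<Rightarrow> real)) \<Rightarrow> 'v set \<Rightarrow> 'v set \<Rightarrow> real" where
  "incidence \<delta> \<tau> \<sigma> = \<delta> (indicator {\<tau>}) \<sigma>"

definition coboundary_operator ::
    "'v set set \<Rightarrow> (('v set \<Rightarrow> real) \<Rightarrow> ('v set \<Rightarrow> real)) \<Rightarrow> bool" where
  "coboundary_operator S \<delta> \<longleftrightarrow>
     (\<forall>\<omega>\<in>cochains S. \<delta> \<omega> \<in> cochains S) \<and>
     (\<forall>\<omega>\<in>cochains S. \<forall>\<eta>\<in>cochains S. \<forall>a b.
        \<delta> (\<lambda>\<sigma>. a * \<omega> \<sigma> + b * \<eta> \<sigma>) = (\<lambda>\<sigma>. a * \<delta> \<omega> \<sigma> + b * \<delta> \<eta> \<sigma>)) \<and>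
     (\<forall>\<omega>\<in>cochains S. \<delta> (\<delta> \<omega>) = (\<lambda>_. 0)) \<and>
     (\<forall>\<tau>\<in>S. \<forall>\<sigma>\<in>S. incidence \<delta> \<tau> \<sigma> \<in> {-1, 0, 1}) \<and>
     (\<forall>\<tau>\<in>S. \<forall>\<sigma>\<in>S. incidence \<delta> \<tau> \<sigma> \<noteq> 0 \<longleftrightarrow> covered_by \<tau> \<sigma>) \<and>
     (\<forall>\<omega>\<in>cochains S. \<forall>\<sigma>\<in>S. \<delta> \<omega> \<sigma> = (\<Sum>\<tau>\<in>faces_below S \<sigma>. \<omega> \<tau> * incidence \<delta> \<tau> \<sigma>))"

text \<open>
  The formula below is meaningful for \<open>\<omega> \<in> summable_cochains S m\<close>. Lemma
  \<open>summable_cochains_eq\<close> shows that this is no restriction for locally summable,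
  uniformly positive weights.
\<close>

definition boundary_operator ::
    "'v set set \<Rightarrow> ('v set \<Rightarrow> real) \<Rightarrow> (('v set \<Rightarrow> real) \<Rightarrow> ('v set \<Rightarrow> real)) \<Rightarrow>
     ('v set \<Rightarrow> real) \<Rightarrow> ('v set \<Rightarrow> real)" where
  "boundary_operator S m \<delta> \<omega> = (\<lambda>\<rho>. if \<rho> \<in> S
     then 1 / m \<rho> * (\<Sum>\<^sub>\<infinity>\<tau>\<in>cofaces_above S \<rho>. m \<tau> * \<omega> \<tau> * incidence \<delta> \<rho> \<tau>)
     else 0)"

definition gauss_bonnet ::
    "'v set set \<Rightarrow> ('v set \<Rightarrow> real) \<Rightarrow> (('v set \<Rightarrow> real) \<Rightarrow> ('v set \<Rightarrow> real)) \<Rightarrow>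
     ('v set \<Rightarrow> real) \<Rightarrow> ('v set \<Rightarrow> real)" where
  "gauss_bonnet S m \<delta> \<omega> = (\<lambda>\<sigma>. \<delta> \<omega> \<sigma> + boundary_operator S m \<delta> \<omega> \<sigma>)"

text \<open>
  An operator is identified with its graph. The third Laplacian is the square of
  \<open>\<delta> + \<partial>\<close>; see lemma \<open>gauss_bonnet_square\<close> for its expression as \<open>\<partial>\<delta> + \<delta>\<partial>\<close>.
\<close>

definition operator_graph ::
    "('v set \<Rightarrow> real) set \<Rightarrow> (('v set \<Rightarrow> real) \<Rightarrow> ('v set \<Rightarrow> real)) \<Rightarrow>
     (('v set \<Rightarrow> real) \<times> ('v set \<Rightarrow> real)) set" where
  "operator_graph D T = {(\<omega>, T \<omega>) | \<omega>. \<omega> \<in> D}"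

definition laplacian_plus ::
    "'v set set \<Rightarrow> ('v set \<Rightarrow> real) \<Rightarrow> (('v set \<Rightarrow> real) \<Rightarrow> ('v set \<Rightarrow> real)) \<Rightarrow>
     (('v set \<Rightarrow> real) \<times> ('v set \<Rightarrow> real)) set" where
  "laplacian_plus S m \<delta> =
     operator_graph (finite_cochains S) (\<lambda>\<omega>. boundary_operator S m \<delta> (\<delta> \<omega>))"

definition laplacian_minus ::
    "'v set set \<Rightarrow> ('v set \<Rightarrow> real) \<Rightarrow> (('v set \<Rightarrow> real) \<Rightarrow> ('v set \<Rightarrow> real)) \<Rightarrow>
     (('v set \<Rightarrow> real) \<times> ('v set \<Rightarrow> real)) set" where
  "laplacian_minus S m \<delta> =
     operator_graph (finite_cochains S) (\<lambda>\<omega>. \<delta> (boundary_operator S m \<delta> \<omega>))"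

definition laplacian_Hodge ::
    "'v set set \<Rightarrow> ('v set \<Rightarrow> real) \<Rightarrow> (('v set \<Rightarrow> real) \<Rightarrow> ('v set \<Rightarrow> real)) \<Rightarrow>
     (('v set \<Rightarrow> real) \<times> ('v set \<Rightarrow> real)) set" where
  "laplacian_Hodge S m \<delta> =
     operator_graph (finite_cochains S) (\<lambda>\<omega>. gauss_bonnet S m \<delta> (gauss_bonnet S m \<delta> \<omega>))"


section \<open>Unbounded operators in the weighted \<open>\<ell>\<^sup>2\<close>-space\<close>

definition l2_operator ::
    "'v set set \<Rightarrow> ('v set \<Rightarrow> real) \<Rightarrow> (('v set \<Rightarrow> real) \<times> ('v set \<Rightarrow> real)) set \<Rightarrow> bool" where
  "l2_operator S m G \<longleftrightarrow>
     G \<subseteq> l2_cochains S m \<times> l2_cochains S m \<and> single_valued G \<and>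
     ((\<lambda>_. 0), (\<lambda>_. 0)) \<in> G \<and>
     (\<forall>(\<omega>, \<xi>)\<in>G. \<forall>(\<eta>, \<zeta>)\<in>G. \<forall>a b.
        ((\<lambda>\<sigma>. a * \<omega> \<sigma> + b * \<eta> \<sigma>), (\<lambda>\<sigma>. a * \<xi> \<sigma> + b * \<zeta> \<sigma>)) \<in> G)"

definition l2_densely_defined ::
    "'v set set \<Rightarrow> ('v set \<Rightarrow> real) \<Rightarrow> (('v set \<Rightarrow> real) \<times> ('v set \<Rightarrow> real)) set \<Rightarrow> bool" where
  "l2_densely_defined S m G \<longleftrightarrow>
     (\<forall>\<eta>\<in>l2_cochains S m. \<forall>e>0. \<exists>\<omega>\<in>Domain G. l2_norm S m (\<lambda>\<sigma>. \<eta> \<sigma> - \<omega> \<sigma>) < e)"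

definition l2_adjoint ::
    "'v set set \<Rightarrow> ('v set \<Rightarrow> real) \<Rightarrow> (('v set \<Rightarrow> real) \<times> ('v set \<Rightarrow> real)) set \<Rightarrow>
     (('v set \<Rightarrow> real) \<times> ('v set \<Rightarrow> real)) set" where
  "l2_adjoint S m G =
     {(\<eta>, \<zeta>) \<in> l2_cochains S m \<times> l2_cochains S m.
        \<forall>(\<omega>, \<xi>)\<in>G. l2_inner S m \<xi> \<eta> = l2_inner S m \<omega> \<zeta>}"

definition l2_closure ::
    "'v set set \<Rightarrow> ('v set \<Rightarrow> real) \<Rightarrow> (('v set \<Rightarrow> real) \<times> ('v set \<Rightarrow> real)) set \<Rightarrow>
     (('v set \<Rightarrow> real) \<times> ('v set \<Rightarrow> real)) set" where
  "l2_closure S m G =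
     {(\<omega>, \<xi>) \<in> l2_cochains S m \<times> l2_cochains S m.
        \<exists>s. (\<forall>n. s n \<in> G) \<and>
            (\<lambda>n. l2_norm S m (\<lambda>\<sigma>. fst (s n) \<sigma> - \<omega> \<sigma>)) \<longlonglongrightarrow> 0 \<and>
            (\<lambda>n. l2_norm S m (\<lambda>\<sigma>. snd (s n) \<sigma> - \<xi> \<sigma>)) \<longlonglongrightarrow> 0}"

definition l2_self_adjoint ::
    "'v set set \<Rightarrow> ('v set \<Rightarrow> real) \<Rightarrow> (('v set \<Rightarrow> real) \<times> ('v set \<Rightarrow> real)) set \<Rightarrow> bool" where
  "l2_self_adjoint S m G \<longleftrightarrow>
     l2_operator S m G \<and> l2_densely_defined S m G \<and> l2_adjoint S m G = G"

text \<open>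
  Since \<open>l2_self_adjoint\<close> requires its argument to be the graph of an operator,
  closability is part of the following definition.
\<close>

definition l2_essentially_self_adjoint ::
    "'v set set \<Rightarrow> ('v set \<Rightarrow> real) \<Rightarrow> (('v set \<Rightarrow> real) \<times> ('v set \<Rightarrow> real)) set \<Rightarrow> bool" where
  "l2_essentially_self_adjoint S m G \<longleftrightarrow>
     l2_operator S m G \<and> l2_densely_defined S m G \<and> l2_self_adjoint S m (l2_closure S m G)"


section \<open>Forman curvature\<close>

text \<open>
  The sum over \<open>\<tau>'\<close> converges for locally summable weights: for fixed \<open>\<rho>\<close> and \<open>\<tau>\<close> every
  \<open>\<sigma>\<close> covering \<open>\<tau>\<close> covers at most one further \<open>\<tau>'\<close> covering \<open>\<rho>\<close>.
\<close>

definition forman_c :: "'v set set \<Rightarrow> ('v set \<Rightarrow> real) \<Rightarrow> 'v set \<Rightarrow> real" where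
  "forman_c S m \<tau> =
     (\<Sum>\<rho>\<in>faces_below S \<tau>. (m \<tau>)\<^sup>2 / m \<rho>)
     + (\<Sum>\<^sub>\<infinity>\<sigma>\<in>cofaces_above S \<tau>. m \<sigma>)
     - (\<Sum>\<rho>\<in>faces_below S \<tau>. \<Sum>\<^sub>\<infinity>\<tau>'\<in>cofaces_above S \<rho> - {\<tau>}.
          \<bar>m \<tau> * m \<tau>' / m \<rho> - (\<Sum>\<^sub>\<infinity>\<sigma>\<in>{\<sigma>\<in>S. covered_by \<tau> \<sigma> \<and> covered_by \<tau>' \<sigma>}. m \<sigma>)\<bar>)"

definition forman_curvature :: "'v set set \<Rightarrow> ('v set \<Rightarrow> real) \<Rightarrow> 'v set \<Rightarrow> real" where
  "forman_curvature S m \<tau> = forman_c S m \<tau> / m \<tau>"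


section \<open>Consistency of the definitions\<close>

lemma uniformly_positive_bound:
  assumes "uniformly_positive S m"
  obtains c where "c > 0" "\<And>\<tau>. \<tau> \<in> S \<Longrightarrow> c \<le> m \<tau>"
proof -
  obtain c where c: "ereal c > 0" "ereal c < (INF \<tau>\<in>S. ereal (m \<tau>))"
    using assms ereal_dense2 unfolding uniformly_positive_def by blast
  have "c \<le> m \<tau>" if "\<tau> \<in> S" for \<tau>
    using c(2) INF_lower[OF that, of "\<lambda>\<tau>. ereal (m \<tau>)"]
    by (metis ereal_less_eq(3) less_imp_le order_trans)
  with c(1) show ?thesis by (intro that[of c]) auto
qed

lemma finite_cofaces_above:
  assumes "locally_summable S m" "uniformly_positive S m" "\<tau> \<in> S"
  shows "finite (cofaces_above S \<tau>)"
proof -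
  obtain c where c: "c > 0" "\<And>\<tau>. \<tau> \<in> S \<Longrightarrow> c \<le> m \<tau>"
    using assms(2) uniformly_positive_bound by blast
  have "m summable_on cofaces_above S \<tau>"
    using assms by (auto simp: locally_summable_def)
  then have "(\<lambda>_. c) summable_on cofaces_above S \<tau>"
    by (rule summable_on_comparison_test) (use c in \<open>auto simp: cofaces_above_def\<close>)
  then show ?thesis
    using c(1) infsum_diverge_constant[of "cofaces_above S \<tau>" c] by auto
qed

lemma summable_cochains_eq:
  assumes "locally_summable S m" "uniformly_positive S m"
  shows "summable_cochains S m = cochains S"
  using finite_cofaces_above[OF assms] by (auto simp: summable_cochains_def)

lemma indicator_cochain: "\<tau> \<in> S \<Longrightarrow> indicator {\<tau>} \<in> cochains S"
  by (auto simp: cochains_def indicator_def)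

lemma gauss_bonnet_square:
  assumes K: "abstract_simplicial_complex V K" and w: "is_weight K m"
    and S: "S = effective_complex K m"
    and cob: "coboundary_operator S \<delta>"
    and ls: "locally_summable S m" and up: "uniformly_positive S m"
    and \<omega>: "\<omega> \<in> cochains S"
  shows "gauss_bonnet S m \<delta> (gauss_bonnet S m \<delta> \<omega>) =
    (\<lambda>\<sigma>. boundary_operator S m \<delta> (\<delta> \<omega>) \<sigma> + \<delta> (boundary_operator S m \<delta> \<omega>) \<sigma>)"
proof -
  let ?B = "boundary_operator S m \<delta>"
  let ?\<theta> = "incidence \<delta>"
  note fin = finite_cofaces_above[OF ls up]
  have SK: "S \<subseteq> K" by (auto simp: S effective_complex_def)
  have mpos: "m \<tau> > 0" if "\<tau> \<in> S" for \<tau> using that w SK by (auto simp: is_weight_def)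
  have finS: "finite \<sigma>" if "\<sigma> \<in> S" for \<sigma>
    using that K SK by (auto simp: abstract_simplicial_complex_def)
  have finb: "finite (faces_below S \<sigma>)" if "\<sigma> \<in> S" for \<sigma>
    by (rule finite_subset[of _ "Pow \<sigma>"])
       (use finS[OF that] in \<open>auto simp: faces_below_def covered_by_def\<close>)
  have dF: "\<delta> \<eta> \<in> cochains S" if "\<eta> \<in> cochains S" for \<eta>
    using cob that by (simp add: coboundary_operator_def)
  have BF: "?B \<eta> \<in> cochains S" for \<eta>
    by (simp add: boundary_operator_def cochains_def)
  have dd: "\<delta> (\<delta> \<eta>) = (\<lambda>_. 0)" if "\<eta> \<in> cochains S" for \<eta>
    using cob that by (simp add: coboundary_operator_def)
  have dlin: "\<delta> (\<lambda>\<sigma>. \<eta> \<sigma> + \<zeta> \<sigma>) = (\<lambda>\<sigma>. \<delta> \<eta> \<sigma> + \<delta> \<zeta> \<sigma>)"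
    if "\<eta> \<in> cochains S" "\<zeta> \<in> cochains S" for \<eta> \<zeta>
  proof -
    have "\<forall>a b. \<delta> (\<lambda>\<sigma>. a * \<eta> \<sigma> + b * \<zeta> \<sigma>) = (\<lambda>\<sigma>. a * \<delta> \<eta> \<sigma> + b * \<delta> \<zeta> \<sigma>)"
      using cob that by (simp add: coboundary_operator_def)
    from this[rule_format, of 1 1] show ?thesis by simp
  qed
  have form: "\<delta> \<eta> \<sigma> = (\<Sum>\<tau>\<in>faces_below S \<sigma>. \<eta> \<tau> * ?\<theta> \<tau> \<sigma>)"
    if "\<eta> \<in> cochains S" "\<sigma> \<in> S" for \<eta> \<sigma>
    using cob that by (simp add: coboundary_operator_def)
  have supp: "?\<theta> \<tau> \<sigma> = 0" if "\<tau> \<in> S" "\<sigma> \<in> S" "\<not> covered_by \<tau> \<sigma>" for \<tau> \<sigma>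
    using cob that by (auto simp: coboundary_operator_def)
  have Bfin: "?B \<eta> \<rho> = 1 / m \<rho> * (\<Sum>\<tau>\<in>cofaces_above S \<rho>. m \<tau> * \<eta> \<tau> * ?\<theta> \<rho> \<tau>)"
    if "\<rho> \<in> S" for \<eta> \<rho>
    using that fin[OF that] by (simp add: boundary_operator_def)
  have Blin: "?B (\<lambda>\<sigma>. \<eta> \<sigma> + \<zeta> \<sigma>) = (\<lambda>\<sigma>. ?B \<eta> \<sigma> + ?B \<zeta> \<sigma>)" for \<eta> \<zeta>
  proof
    fix \<rho> show "?B (\<lambda>\<sigma>. \<eta> \<sigma> + \<zeta> \<sigma>) \<rho> = ?B \<eta> \<rho> + ?B \<zeta> \<rho>"
    proof (cases "\<rho> \<in> S")
      case True
      then show ?thesis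
        by (simp add: Bfin algebra_simps sum.distrib add_divide_distrib)
    qed (simp add: boundary_operator_def)
  qed
  have BB: "?B (?B \<omega>) \<rho> = 0" for \<rho>
  proof (cases "\<rho> \<in> S")
    case r: True
    let ?C = "cofaces_above S \<rho>"
    let ?U = "\<Union>\<tau>\<in>?C. cofaces_above S \<tau>"
    have CS: "?C \<subseteq> S" by (auto simp: cofaces_above_def)
    have US: "?U \<subseteq> S" by (auto simp: cofaces_above_def)
    have finU: "finite ?U" using fin[OF r] fin CS by auto
    have inner: "m \<tau> * ?B \<omega> \<tau> * ?\<theta> \<rho> \<tau> = (\<Sum>\<sigma>\<in>?U. m \<sigma> * \<omega> \<sigma> * (?\<theta> \<rho> \<tau> * ?\<theta> \<tau> \<sigma>))"
      if "\<tau> \<in> ?C" for \<tau>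
    proof -
      have tS: "\<tau> \<in> S" using that CS by auto
      have "m \<tau> * ?B \<omega> \<tau> = (\<Sum>\<sigma>\<in>cofaces_above S \<tau>. m \<sigma> * \<omega> \<sigma> * ?\<theta> \<tau> \<sigma>)"
        using mpos[OF tS] by (simp add: Bfin[OF tS])
      also have "\<dots> = (\<Sum>\<sigma>\<in>?U. m \<sigma> * \<omega> \<sigma> * ?\<theta> \<tau> \<sigma>)"
      proof (rule sum.mono_neutral_left[OF finU])
        show "cofaces_above S \<tau> \<subseteq> ?U" using that by auto
        show "\<forall>\<sigma>\<in>?U - cofaces_above S \<tau>. m \<sigma> * \<omega> \<sigma> * ?\<theta> \<tau> \<sigma> = 0"
          using supp[OF tS] by (auto simp: cofaces_above_def)
      qed
      finally show ?thesis
        by (simp add: sum_distrib_left sum_distrib_right mult_ac)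
    qed
    have zero: "(\<Sum>\<tau>\<in>?C. ?\<theta> \<rho> \<tau> * ?\<theta> \<tau> \<sigma>) = 0" if "\<sigma> \<in> S" for \<sigma>
    proof -
      let ?I = "faces_below S \<sigma> \<inter> ?C"
      have "0 = \<delta> (\<delta> (indicator {\<rho>})) \<sigma>"
        by (simp add: dd[OF indicator_cochain[OF r]])
      also have "\<dots> = (\<Sum>\<tau>\<in>faces_below S \<sigma>. ?\<theta> \<rho> \<tau> * ?\<theta> \<tau> \<sigma>)"
        by (subst form[OF dF[OF indicator_cochain[OF r]] that]) (simp add: incidence_def)
      also have "\<dots> = (\<Sum>\<tau>\<in>?I. ?\<theta> \<rho> \<tau> * ?\<theta> \<tau> \<sigma>)"
        by (rule sum.mono_neutral_right[OF finb[OF that]])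
           (use supp[OF r] in \<open>auto simp: faces_below_def cofaces_above_def\<close>)
      also have "\<dots> = (\<Sum>\<tau>\<in>?C. ?\<theta> \<rho> \<tau> * ?\<theta> \<tau> \<sigma>)"
        by (rule sum.mono_neutral_left[OF fin[OF r]])
           (use supp that in \<open>auto simp: faces_below_def cofaces_above_def\<close>)
      finally show ?thesis by simp
    qed
    have "(\<Sum>\<tau>\<in>?C. m \<tau> * ?B \<omega> \<tau> * ?\<theta> \<rho> \<tau>)
        = (\<Sum>\<tau>\<in>?C. \<Sum>\<sigma>\<in>?U. m \<sigma> * \<omega> \<sigma> * (?\<theta> \<rho> \<tau> * ?\<theta> \<tau> \<sigma>))"
      by (rule sum.cong) (use inner in auto)
    also have "\<dots> = (\<Sum>\<sigma>\<in>?U. m \<sigma> * \<omega> \<sigma> * (\<Sum>\<tau>\<in>?C. ?\<theta> \<rho> \<tau> * ?\<theta> \<tau> \<sigma>))"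
      by (subst sum.swap) (simp add: sum_distrib_left)
    also have "\<dots> = 0"
      by (rule sum.neutral) (use zero US in auto)
    finally show ?thesis by (simp add: Bfin[OF r])
  qed (simp add: boundary_operator_def)
  show ?thesis
    unfolding gauss_bonnet_def
    by (simp add: dlin[OF dF[OF \<omega>] BF] Blin dd[OF \<omega>] BB add_ac)
qed

end

theory Submission
  imports Defs
begin

text \<open>
  Uniform positivity makes the complex locally finite, so all operators act pointwise on arbitrary
  cochains. A nonnegative symmetric operator \<open>T\<close> is essentially self-adjoint once
  \<open>T\<^sup>* \<eta> = - l \<eta>\<close> with some \<open>l > 0\<close> forces \<open>\<eta> = 0\<close>. For the Hodge Laplacian such an \<open>\<eta>\<close> is a pointwise
  solution; being square summable for a weight bounded away from zero, \<open>\<bar>\<eta>\<bar>\<close> attains its maximum,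
  where the diagonal of the Laplacian minus the absolute off-diagonal row sum is the Forman
  curvature, and a large \<open>l\<close> gives a contradiction. If \<open>\<partial>\<delta>\<eta> = - l \<eta>\<close>, then \<open>\<partial>\<eta> = 0\<close> because
  \<open>\<partial>\<partial> = 0\<close>, so \<open>\<eta>\<close> solves the Hodge equation; the case \<open>\<delta>\<partial>\<close> is dual.
\<close>

section \<open>Weighted square summable functions\<close>

text \<open>One real \<open>l\<close> suffices because of nonnegativity: \<open>l + T\<close> then
  expands norms by at least the factor \<open>l\<close>, so its closure has closed range, and
  excluding \<open>- l\<close> as an eigenvalue of the adjoint makes that range the whole space. The
  maximum principle is applied to the sum of both halves because the curvature records a
  cancellation between them. If \<tau> and \<tau>' are distinct with common face \<rho>, and
  \<sigma> lies above both, then \<delta>\<delta> = 0 forces opposite signs in \<delta>\<partial>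
  and \<partial>\<delta>. Up to sign the matrix entry is therefore
  \<open>m \<tau> * m \<tau>' / m \<rho>\<close> minus the total weight of all such \<sigma>, the
  quantity inside the absolute value of the curvature. Two obstacles shape the argument. A
  deficiency function is in general not finitely supported, so Green's formula must work with one
  finitely supported argument only. And if the empty simplex is absent from \<open>S\<close>,
  vertices have no common face through which the cancellation could be organised; they get their own
  estimate.\<close>

locale weighted_l2 =
  fixes S :: "'v set set" and m :: "'v set \<Rightarrow> real"
  assumes weight_pos: "\<tau> \<in> S \<Longrightarrow> 0 < m \<tau>"
begin

abbreviation "\<H> \<equiv> l2_cochains S m"
abbreviation "ip \<equiv> l2_inner S m"
abbreviation "Fin \<equiv> finite_cochains S"

text \<open>The product is dominated pointwise by the sum of the two squares, so no Cauchy-Schwarz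
  inequality is involved; that inequality is derived later from the bilinearity which this
  summability makes available.\<close>

lemma l2_mult_summable:
  assumes "x \<in> \<H>" "y \<in> \<H>"
  shows "(\<lambda>\<sigma>. m \<sigma> * x \<sigma> * y \<sigma>) summable_on S"
proof -
  have "(\<lambda>\<sigma>. m \<sigma> * (x \<sigma>)\<^sup>2 + m \<sigma> * (y \<sigma>)\<^sup>2) summable_on S"
    using assms by (intro summable_on_add) (auto simp: l2_cochains_def)
  moreover have "norm (m \<sigma> * x \<sigma> * y \<sigma>) \<le> m \<sigma> * (x \<sigma>)\<^sup>2 + m \<sigma> * (y \<sigma>)\<^sup>2" if "\<sigma> \<in> S" for \<sigma>
  proof -
    have "\<bar>x \<sigma>\<bar> * \<bar>y \<sigma>\<bar> \<le> (x \<sigma>)\<^sup>2 + (y \<sigma>)\<^sup>2"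
    proof -
      have "0 \<le> \<bar>x \<sigma>\<bar> * \<bar>y \<sigma>\<bar>" by simp
      with sum_squares_bound[of "\<bar>x \<sigma>\<bar>" "\<bar>y \<sigma>\<bar>"] show ?thesis
        unfolding power2_abs by linarith
    qed
    then have "m \<sigma> * (\<bar>x \<sigma>\<bar> * \<bar>y \<sigma>\<bar>) \<le> m \<sigma> * ((x \<sigma>)\<^sup>2 + (y \<sigma>)\<^sup>2)"
      using weight_pos[OF that] by (intro mult_left_mono) auto
    then show ?thesis
      using weight_pos[OF that] by (simp add: abs_mult algebra_simps)
  qed
  ultimately have "(\<lambda>\<sigma>. norm (m \<sigma> * x \<sigma> * y \<sigma>)) summable_on S"
    by (rule summable_on_comparison_test) auto
  then show ?thesis
    by (rule abs_summable_summable)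
qed

lemma l2_zero [simp]: "(\<lambda>_. 0) \<in> \<H>"
  by (simp add: l2_cochains_def cochains_def)

lemma l2_lincomb:
  assumes "x \<in> \<H>" "y \<in> \<H>"
  shows "(\<lambda>\<sigma>. a * x \<sigma> + b * y \<sigma>) \<in> \<H>"
proof -
  have "(\<lambda>\<sigma>. a\<^sup>2 * (m \<sigma> * x \<sigma> * x \<sigma>) + (2 * a * b * (m \<sigma> * x \<sigma> * y \<sigma>)
      + b\<^sup>2 * (m \<sigma> * y \<sigma> * y \<sigma>))) summable_on S"
    by (intro summable_on_add summable_on_cmult_right l2_mult_summable assms)
  also have "(\<lambda>\<sigma>. a\<^sup>2 * (m \<sigma> * x \<sigma> * x \<sigma>) + (2 * a * b * (m \<sigma> * x \<sigma> * y \<sigma>)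
      + b\<^sup>2 * (m \<sigma> * y \<sigma> * y \<sigma>))) = (\<lambda>\<sigma>. m \<sigma> * (a * x \<sigma> + b * y \<sigma>)\<^sup>2)"
    by (simp add: fun_eq_iff power2_eq_square algebra_simps)
  finally show ?thesis
    using assms by (simp add: l2_cochains_def cochains_def)
qed

lemma l2_diff: "x \<in> \<H> \<Longrightarrow> y \<in> \<H> \<Longrightarrow> (\<lambda>\<sigma>. x \<sigma> - y \<sigma>) \<in> \<H>"
  using l2_lincomb[of x y 1 "-1"] by simp

section \<open>Bilinearity, definiteness and the Cauchy-Schwarz inequality\<close>

lemma ip_commute: "ip x y = ip y x"
  unfolding l2_inner_def by (simp add: mult_ac)

lemma ip_lincomb_left:
  assumes "x \<in> \<H>" "y \<in> \<H>" "z \<in> \<H>"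
  shows "ip (\<lambda>\<sigma>. a * x \<sigma> + b * y \<sigma>) z = a * ip x z + b * ip y z"
proof -
  have "ip (\<lambda>\<sigma>. a * x \<sigma> + b * y \<sigma>) z
      = (\<Sum>\<^sub>\<infinity>\<sigma>\<in>S. a * (m \<sigma> * x \<sigma> * z \<sigma>) + b * (m \<sigma> * y \<sigma> * z \<sigma>))"
    unfolding l2_inner_def by (simp add: algebra_simps)
  also have "\<dots> = (\<Sum>\<^sub>\<infinity>\<sigma>\<in>S. a * (m \<sigma> * x \<sigma> * z \<sigma>)) + (\<Sum>\<^sub>\<infinity>\<sigma>\<in>S. b * (m \<sigma> * y \<sigma> * z \<sigma>))"
    by (intro infsum_add summable_on_cmult_right l2_mult_summable assms)
  finally show ?thesis
    by (simp add: l2_inner_def infsum_cmult_right')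
qed

lemma ip_diff_left:
  "x \<in> \<H> \<Longrightarrow> y \<in> \<H> \<Longrightarrow> z \<in> \<H> \<Longrightarrow> ip (\<lambda>\<sigma>. x \<sigma> - y \<sigma>) z = ip x z - ip y z"
  using ip_lincomb_left[of x y z 1 "-1"] by simp

text \<open>The coefficients are kept free because the expansion serves several purposes:
  Cauchy-Schwarz, the norm of \<open>l + T\<close>, midpoints of a minimising sequence and
  one-parameter variations.\<close>

lemma ip_lincomb_square:
  assumes "x \<in> \<H>" "y \<in> \<H>"
  shows "ip (\<lambda>\<sigma>. a * x \<sigma> + b * y \<sigma>) (\<lambda>\<sigma>. a * x \<sigma> + b * y \<sigma>)
    = a\<^sup>2 * ip x x + 2 * a * b * ip x y + b\<^sup>2 * ip y y"
proof -
  let ?z = "\<lambda>\<sigma>. a * x \<sigma> + b * y \<sigma>"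
  have "ip x ?z = a * ip x x + b * ip x y" "ip y ?z = a * ip x y + b * ip y y"
    using ip_lincomb_left[OF assms assms(1)] ip_lincomb_left[OF assms assms(2)]
    by (simp_all add: ip_commute[of x ?z] ip_commute[of y ?z] ip_commute[of y x])
  then show ?thesis
    unfolding ip_lincomb_left[OF assms l2_lincomb[OF assms]]
    by (simp add: power2_eq_square algebra_simps)
qed

lemma ip_diff_square:
  assumes "x \<in> \<H>" "y \<in> \<H>"
  shows "ip (\<lambda>\<sigma>. x \<sigma> - y \<sigma>) (\<lambda>\<sigma>. x \<sigma> - y \<sigma>) = ip x x - 2 * ip x y + ip y y"
  using ip_lincomb_square[OF assms, of 1 "-1"] by simp

lemma ip_nonneg: "0 \<le> ip x x"
  unfolding l2_inner_def using weight_pos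
  by (intro infsum_nonneg) (simp add: mult.assoc less_imp_le)

lemma sum_le_ip:
  assumes "x \<in> \<H>" "finite F" "F \<subseteq> S"
  shows "(\<Sum>\<sigma>\<in>F. m \<sigma> * (x \<sigma>)\<^sup>2) \<le> ip x x"
proof -
  have "(\<Sum>\<^sub>\<infinity>\<sigma>\<in>F. m \<sigma> * (x \<sigma>)\<^sup>2) \<le> (\<Sum>\<^sub>\<infinity>\<sigma>\<in>S. m \<sigma> * (x \<sigma>)\<^sup>2)"
    using assms weight_pos by (intro infsum_mono_neutral) (auto simp: l2_cochains_def less_imp_le)
  then show ?thesis
    using assms(2) by (simp add: l2_inner_def power2_eq_square mult.assoc)
qed

lemma ip_definite:
  assumes "x \<in> \<H>" "ip x x = 0"
  shows "x = (\<lambda>_. 0)"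
proof
  fix \<sigma>
  show "x \<sigma> = 0"
  proof (cases "\<sigma> \<in> S")
    case True
    then show ?thesis
      using sum_le_ip[of x "{\<sigma>}"] assms weight_pos[OF True] by (simp add: mult_le_0_iff)
  qed (use assms in \<open>auto simp: l2_cochains_def cochains_def\<close>)
qed

lemma ip_Cauchy_Schwarz:
  assumes "x \<in> \<H>" "y \<in> \<H>"
  shows "(ip x y)\<^sup>2 \<le> ip x x * ip y y"
proof (cases "ip y y = 0")
  case True
  then show ?thesis
    using ip_definite[OF assms(2) True] by (simp add: l2_inner_def)
next
  case False
  then have pos: "ip y y > 0"
    using ip_nonneg[of y] by linarith
  \<comment> \<open>The vector tested is the component of \<open>x\<close> orthogonal to
    \<open>y\<close>, multiplied by \<open>ip y y\<close> to avoid a division.\<close>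
  have "0 \<le> (ip y y)\<^sup>2 * ip x x + 2 * ip y y * (- ip x y) * ip x y + (- ip x y)\<^sup>2 * ip y y"
    using ip_nonneg[of "\<lambda>\<sigma>. ip y y * x \<sigma> + (- ip x y) * y \<sigma>"] ip_lincomb_square[OF assms]
    by metis
  also have "\<dots> = ip y y * (ip x x * ip y y - (ip x y)\<^sup>2)"
    by (simp add: power2_eq_square algebra_simps)
  finally show ?thesis
    using pos by (simp add: zero_le_mult_iff)
qed

section \<open>Convergence and completeness\<close>

lemma l2_norm_tendsto_0_iff:
  "(\<lambda>n. l2_norm S m (f n)) \<longlonglongrightarrow> 0 \<longleftrightarrow> (\<lambda>n. ip (f n) (f n)) \<longlonglongrightarrow> 0"
proof
  assume "(\<lambda>n. l2_norm S m (f n)) \<longlonglongrightarrow> 0"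
  then have "(\<lambda>n. (l2_norm S m (f n))\<^sup>2) \<longlonglongrightarrow> 0\<^sup>2"
    by (rule tendsto_power)
  then show "(\<lambda>n. ip (f n) (f n)) \<longlonglongrightarrow> 0"
    by (simp add: l2_norm_def ip_nonneg)
next
  assume "(\<lambda>n. ip (f n) (f n)) \<longlonglongrightarrow> 0"
  from tendsto_real_sqrt[OF this] show "(\<lambda>n. l2_norm S m (f n)) \<longlonglongrightarrow> 0"
    by (simp add: l2_norm_def)
qed

lemma ip_tendsto:
  assumes x: "\<And>n. x n \<in> \<H>" "x' \<in> \<H>" "y \<in> \<H>"
    and lim: "(\<lambda>n. ip (\<lambda>\<sigma>. x n \<sigma> - x' \<sigma>) (\<lambda>\<sigma>. x n \<sigma> - x' \<sigma>)) \<longlonglongrightarrow> 0"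
  shows "(\<lambda>n. ip (x n) y) \<longlonglongrightarrow> ip x' y"
proof -
  let ?q = "\<lambda>n. ip (\<lambda>\<sigma>. x n \<sigma> - x' \<sigma>) (\<lambda>\<sigma>. x n \<sigma> - x' \<sigma>)"
  have "(\<lambda>n. sqrt (?q n * ip y y)) \<longlonglongrightarrow> sqrt (0 * ip y y)"
    by (intro tendsto_real_sqrt tendsto_mult_right lim)
  then have null: "(\<lambda>n. sqrt (?q n * ip y y)) \<longlonglongrightarrow> 0" by simp
  have bound: "norm (ip (x n) y - ip x' y) \<le> sqrt (?q n * ip y y)" for n
  proof -
    have "(ip (x n) y - ip x' y)\<^sup>2 \<le> ?q n * ip y y"
      unfolding ip_diff_left[OF x(1) x(2,3), symmetric]
      by (rule ip_Cauchy_Schwarz[OF l2_diff[OF x(1) x(2)] x(3)])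
    from real_sqrt_le_mono[OF this] show ?thesis
      unfolding real_sqrt_abs real_norm_def .
  qed
  have "(\<lambda>n. ip (x n) y - ip x' y) \<longlonglongrightarrow> 0"
    by (rule Lim_null_comparison[OF always_eventually null]) (intro allI bound)
  then show ?thesis
    by (rule LIM_zero_cancel)
qed

text \<open>Positivity of the weight makes every point value Cauchy, which yields a pointwise limit;
  norm convergence follows by passing to the limit on finite sets. The bound
  \<open>e i + e j\<close> is the form in which the parallelogram identity controls a minimising
  sequence.\<close>

lemma l2_complete:
  assumes x: "\<And>n. x n \<in> \<H>" and e: "e \<longlonglongrightarrow> 0"
    and Cauchy: "\<And>i j. ip (\<lambda>\<sigma>. x i \<sigma> - x j \<sigma>) (\<lambda>\<sigma>. x i \<sigma> - x j \<sigma>) \<le> e i + e j"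
  obtains y where "y \<in> \<H>"
    and "(\<lambda>n. ip (\<lambda>\<sigma>. x n \<sigma> - y \<sigma>) (\<lambda>\<sigma>. x n \<sigma> - y \<sigma>)) \<longlonglongrightarrow> 0"
proof -
  define y where "y \<sigma> = lim (\<lambda>n. x n \<sigma>)" for \<sigma>
  have lim: "(\<lambda>n. x n \<sigma>) \<longlonglongrightarrow> y \<sigma>" if "\<sigma> \<in> S" for \<sigma>
  proof -
    have bound: "m \<sigma> * (x i \<sigma> - x j \<sigma>)\<^sup>2 \<le> e i + e j" for i j
      using sum_le_ip[OF l2_diff[OF x x], of "{\<sigma>}" i j] Cauchy[of i j] that by simp
    have "Cauchy (\<lambda>n. x n \<sigma>)"
    proof (rule CauchyI)
      fix \<epsilon> :: real
      assume "\<epsilon> > 0"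
      then have "m \<sigma> * \<epsilon>\<^sup>2 / 2 > 0"
        using weight_pos[OF that] by simp
      with e obtain N where N: "\<And>n. n \<ge> N \<Longrightarrow> norm (e n - 0) < m \<sigma> * \<epsilon>\<^sup>2 / 2"
        using LIMSEQ_D by blast
      have "norm (x i \<sigma> - x j \<sigma>) < \<epsilon>" if "i \<ge> N" "j \<ge> N" for i j
      proof -
        have "m \<sigma> * (x i \<sigma> - x j \<sigma>)\<^sup>2 < m \<sigma> * \<epsilon>\<^sup>2"
          using bound[of i j] N[OF that(1)] N[OF that(2)] by simp
        then have "(x i \<sigma> - x j \<sigma>)\<^sup>2 < \<epsilon>\<^sup>2"
          using weight_pos[OF \<open>\<sigma> \<in> S\<close>] by simp
        then show ?thesis
          using \<open>\<epsilon> > 0\<close> power2_less_imp_less[of "\<bar>x i \<sigma> - x j \<sigma>\<bar>" \<epsilon>] by simp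
      qed
      then show "\<exists>N. \<forall>i\<ge>N. \<forall>j\<ge>N. norm (x i \<sigma> - x j \<sigma>) < \<epsilon>" by blast
    qed
    then show ?thesis
      by (simp add: y_def Cauchy_convergent_iff convergent_LIMSEQ_iff)
  qed
  have y0: "y \<sigma> = 0" if "\<sigma> \<notin> S" for \<sigma>
    using x that by (simp add: y_def l2_cochains_def cochains_def)
  \<comment> \<open>A Fatou argument: on a finite set the limit in \<open>j\<close> may be taken
    termwise, and \<open>e j\<close> disappears.\<close>
  have partial: "(\<Sum>\<sigma>\<in>F. m \<sigma> * (x i \<sigma> - y \<sigma>)\<^sup>2) \<le> e i" if "finite F" "F \<subseteq> S" for F i
  proof (rule tendsto_le[OF sequentially_bot])
    show "(\<lambda>j. \<Sum>\<sigma>\<in>F. m \<sigma> * (x i \<sigma> - x j \<sigma>)\<^sup>2) \<longlonglongrightarrow> (\<Sum>\<sigma>\<in>F. m \<sigma> * (x i \<sigma> - y \<sigma>)\<^sup>2)"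
      using that by (intro tendsto_sum tendsto_mult_left tendsto_power tendsto_diff tendsto_const lim) auto
    show "(\<lambda>j. e i + e j) \<longlonglongrightarrow> e i"
      using tendsto_add[OF tendsto_const e] by simp
    show "\<forall>\<^sub>F j in sequentially. (\<Sum>\<sigma>\<in>F. m \<sigma> * (x i \<sigma> - x j \<sigma>)\<^sup>2) \<le> e i + e j"
      using order_trans[OF sum_le_ip[OF l2_diff[OF x x] that] Cauchy] by simp
  qed
  have summ: "(\<lambda>\<sigma>. m \<sigma> * (x i \<sigma> - y \<sigma>)\<^sup>2) summable_on S" for i
  proof (rule nonneg_bdd_above_summable_on)
    show "bdd_above (sum (\<lambda>\<sigma>. m \<sigma> * (x i \<sigma> - y \<sigma>)\<^sup>2) ` {F. F \<subseteq> S \<and> finite F})"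
      using partial by (intro bdd_aboveI[of _ "e i"]) auto
  qed (use weight_pos in \<open>auto simp: less_imp_le\<close>)
  have diff: "(\<lambda>\<sigma>. x i \<sigma> - y \<sigma>) \<in> \<H>" for i
    using summ[of i] x[of i] y0 by (simp add: l2_cochains_def cochains_def)
  have le: "ip (\<lambda>\<sigma>. x i \<sigma> - y \<sigma>) (\<lambda>\<sigma>. x i \<sigma> - y \<sigma>) \<le> e i" for i
  proof -
    have "(\<Sum>\<^sub>\<infinity>\<sigma>\<in>S. m \<sigma> * (x i \<sigma> - y \<sigma>)\<^sup>2) \<le> e i"
      by (rule infsum_le_finite_sums[OF summ]) (use partial in auto)
    then show ?thesis
      by (simp add: l2_inner_def power2_eq_square mult.assoc)
  qed
  show ?thesis
  proof (rule that)
    show "y \<in> \<H>"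
      using l2_diff[OF x[of 0] diff[of 0]] by simp
    show "(\<lambda>n. ip (\<lambda>\<sigma>. x n \<sigma> - y \<sigma>) (\<lambda>\<sigma>. x n \<sigma> - y \<sigma>)) \<longlonglongrightarrow> 0"
      by (rule tendsto_sandwich[OF _ _ tendsto_const e]) (use le ip_nonneg in auto)
  qed
qed

section \<open>Finitely supported cochains as test functions\<close>

lemma finite_cochain_l2: "x \<in> Fin \<Longrightarrow> x \<in> \<H>"
  by (auto simp: finite_cochains_def l2_cochains_def
      intro!: finite_nonzero_values_imp_summable_on elim: rev_finite_subset)

lemma finite_cochain_lincomb:
  assumes "x \<in> Fin" "y \<in> Fin"
  shows "(\<lambda>\<sigma>. a * x \<sigma> + b * y \<sigma>) \<in> Fin"
proof -
  have "{\<sigma>. a * x \<sigma> + b * y \<sigma> \<noteq> 0} \<subseteq> {\<sigma>. x \<sigma> \<noteq> 0} \<union> {\<sigma>. y \<sigma> \<noteq> 0}" by auto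
  with assms show ?thesis
    by (auto simp: finite_cochains_def cochains_def intro: finite_subset)
qed

lemma indicator_finite_cochain: "\<tau> \<in> S \<Longrightarrow> indicator {\<tau>} \<in> Fin"
  by (auto simp: finite_cochains_def cochains_def indicator_def)

text \<open>Only the product has to vanish off \<open>F\<close>, so the pairing of a finitely
  supported cochain with an arbitrary one is covered.\<close>

lemma ip_finite_sum:
  assumes "finite F" "F \<subseteq> S" "\<And>\<sigma>. \<sigma> \<in> S - F \<Longrightarrow> x \<sigma> * y \<sigma> = 0"
  shows "ip x y = (\<Sum>\<sigma>\<in>F. m \<sigma> * x \<sigma> * y \<sigma>)"
proof -
  have "ip x y = (\<Sum>\<^sub>\<infinity>\<sigma>\<in>F. m \<sigma> * x \<sigma> * y \<sigma>)"
    unfolding l2_inner_def by (rule infsum_cong_neutral) (use assms in auto)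
  then show ?thesis
    using assms(1) by simp
qed

lemma ip_indicator: "\<tau> \<in> S \<Longrightarrow> ip (indicator {\<tau>}) y = m \<tau> * y \<tau>"
  by (subst ip_finite_sum[of "{\<tau>}"]) (auto simp: indicator_def)

text \<open>Indicators of single simplices already recover all values. This is what makes the
  adjoint single-valued.\<close>

lemma eq_if_ip_eq:
  assumes "x \<in> \<H>" "y \<in> \<H>" "\<And>\<omega>. \<omega> \<in> Fin \<Longrightarrow> ip \<omega> x = ip \<omega> y"
  shows "x = y"
proof
  fix \<sigma>
  show "x \<sigma> = y \<sigma>"
  proof (cases "\<sigma> \<in> S")
    case True
    then show ?thesis
      using assms(3)[OF indicator_finite_cochain[OF True]] weight_pos[OF True]
      by (simp add: ip_indicator)
  qed (use assms in \<open>auto simp: l2_cochains_def cochains_def\<close>)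
qed

lemma finite_cochains_dense:
  assumes x: "x \<in> \<H>" and e: "e > 0"
  obtains \<omega> where "\<omega> \<in> Fin" "l2_norm S m (\<lambda>\<sigma>. x \<sigma> - \<omega> \<sigma>) < e"
proof -
  let ?f = "\<lambda>\<sigma>. m \<sigma> * (x \<sigma>)\<^sup>2"
  have summ: "?f summable_on S"
    using x by (simp add: l2_cochains_def)
  \<comment> \<open>The approximation is non-strict; the factor \<open>1/2\<close> leaves room for
    the strict inequality below.\<close>
  from infsum_finite_approximation[OF summ, of "e\<^sup>2 / 2"] e
  obtain F where F: "finite F" "F \<subseteq> S" "dist (sum ?f F) (infsum ?f S) \<le> e\<^sup>2 / 2" by auto
  define \<omega> where "\<omega> \<sigma> = (if \<sigma> \<in> F then x \<sigma> else 0)" for \<sigma>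
  have "ip (\<lambda>\<sigma>. x \<sigma> - \<omega> \<sigma>) (\<lambda>\<sigma>. x \<sigma> - \<omega> \<sigma>) = infsum ?f (S - F)"
    unfolding l2_inner_def
    by (intro infsum_cong_neutral) (auto simp: \<omega>_def power2_eq_square)
  also have "\<dots> = infsum ?f S - sum ?f F"
    using infsum_Diff[OF summ _ F(2)] F(1) by simp
  also have "\<dots> < e\<^sup>2"
  proof -
    have "0 < e\<^sup>2" using e by simp
    with F(3) show ?thesis unfolding dist_real_def by linarith
  qed
  finally have "l2_norm S m (\<lambda>\<sigma>. x \<sigma> - \<omega> \<sigma>) < e"
    using e real_sqrt_less_mono by (fastforce simp: l2_norm_def)
  moreover have "\<omega> \<in> Fin"
    using F x by (auto simp: \<omega>_def finite_cochains_def cochains_def l2_cochains_def)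
  ultimately show ?thesis using that by blast
qed

end


section \<open>A criterion for essential self-adjointness\<close>

text \<open>The assumption \<open>deficiency\<close> says that \<open>- l\<close> is not an
  eigenvalue of the adjoint. It is phrased weakly, against finitely supported test functions, so
  that it can be verified without knowing the domain of the adjoint.\<close>

locale nonneg_symmetric_operator = weighted_l2 S m
  for S :: "'v set set" and m +
  fixes T :: "('v set \<Rightarrow> real) \<Rightarrow> 'v set \<Rightarrow> real" and l :: real
  assumes maps: "\<omega> \<in> finite_cochains S \<Longrightarrow> T \<omega> \<in> l2_cochains S m"
    and linear: "\<omega> \<in> finite_cochains S \<Longrightarrow> \<eta> \<in> finite_cochains S \<Longrightarrow>
      T (\<lambda>\<sigma>. a * \<omega> \<sigma> + b * \<eta> \<sigma>) = (\<lambda>\<sigma>. a * T \<omega> \<sigma> + b * T \<eta> \<sigma>)"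
    and symmetric: "\<omega> \<in> finite_cochains S \<Longrightarrow> \<eta> \<in> finite_cochains S \<Longrightarrow>
      l2_inner S m (T \<omega>) \<eta> = l2_inner S m \<omega> (T \<eta>)"
    and nonneg: "\<omega> \<in> finite_cochains S \<Longrightarrow> 0 \<le> l2_inner S m (T \<omega>) \<omega>"
    and l_pos: "l > 0"
    and deficiency: "\<eta> \<in> l2_cochains S m \<Longrightarrow>
      (\<And>\<omega>. \<omega> \<in> finite_cochains S \<Longrightarrow> l2_inner S m (T \<omega>) \<eta> = - l * l2_inner S m \<omega> \<eta>) \<Longrightarrow>
      \<eta> = (\<lambda>_. 0)"
begin

text \<open>This is \<open>l + T\<close>; the coefficient \<open>1\<close> keeps it literally of the
  form treated by the rules for linear combinations.\<close>

definition shifted :: "('v set \<Rightarrow> real) \<Rightarrow> 'v set \<Rightarrow> real" where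
  "shifted \<omega> = (\<lambda>\<sigma>. l * \<omega> \<sigma> + 1 * T \<omega> \<sigma>)"

lemma shifted_l2: "\<omega> \<in> Fin \<Longrightarrow> shifted \<omega> \<in> \<H>"
  unfolding shifted_def by (intro l2_lincomb finite_cochain_l2 maps)

lemma shifted_linear:
  assumes "\<omega> \<in> Fin" "\<eta> \<in> Fin"
  shows "shifted (\<lambda>\<sigma>. a * \<omega> \<sigma> + b * \<eta> \<sigma>) = (\<lambda>\<sigma>. a * shifted \<omega> \<sigma> + b * shifted \<eta> \<sigma>)"
  by (simp add: shifted_def linear[OF assms] algebra_simps)

lemma ip_shifted:
  assumes "\<omega> \<in> Fin" "\<eta> \<in> \<H>"
  shows "ip (shifted \<omega>) \<eta> = l * ip \<omega> \<eta> + ip (T \<omega>) \<eta>"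
  unfolding shifted_def
  using ip_lincomb_left[OF finite_cochain_l2[OF assms(1)] maps[OF assms(1)] assms(2), of l 1] by simp

text \<open>The cross term \<open>2 * l * ip (T \<omega>) \<omega>\<close> is nonnegative, so the
  image under \<open>l + T\<close> controls \<omega> and \<open>T \<omega>\<close> separately:
  sequences with Cauchy images are Cauchy in the graph norm.\<close>

lemma shifted_square_ge:
  assumes "\<omega> \<in> Fin"
  shows "l\<^sup>2 * ip \<omega> \<omega> \<le> ip (shifted \<omega>) (shifted \<omega>)"
    and "ip (T \<omega>) (T \<omega>) \<le> ip (shifted \<omega>) (shifted \<omega>)"
proof -
  have "ip (shifted \<omega>) (shifted \<omega>) = l\<^sup>2 * ip \<omega> \<omega> + 2 * l * ip (T \<omega>) \<omega> + ip (T \<omega>) (T \<omega>)"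
    unfolding shifted_def
    using ip_lincomb_square[OF finite_cochain_l2[OF assms] maps[OF assms], of l 1]
    by (simp add: ip_commute[of \<omega> "T \<omega>"])
  moreover have "0 \<le> 2 * l * ip (T \<omega>) \<omega>"
    using nonneg[OF assms] l_pos by simp
  moreover have "0 \<le> l\<^sup>2 * ip \<omega> \<omega>" "0 \<le> ip (T \<omega>) (T \<omega>)"
    by (simp_all add: ip_nonneg)
  ultimately show "l\<^sup>2 * ip \<omega> \<omega> \<le> ip (shifted \<omega>) (shifted \<omega>)"
      "ip (T \<omega>) (T \<omega>) \<le> ip (shifted \<omega>) (shifted \<omega>)"
    by linarith+
qed

section \<open>The closure and the adjoint of the graph\<close>

abbreviation "Gr \<equiv> operator_graph Fin T"

lemma adjoint_iff:
  "(\<eta>, \<zeta>) \<in> l2_adjoint S m Gr \<longleftrightarrow>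
    \<eta> \<in> \<H> \<and> \<zeta> \<in> \<H> \<and> (\<forall>\<omega>\<in>Fin. ip (T \<omega>) \<eta> = ip \<omega> \<zeta>)"
  by (auto simp: l2_adjoint_def operator_graph_def)

lemma closure_iff:
  "(\<eta>, \<zeta>) \<in> l2_closure S m Gr \<longleftrightarrow> \<eta> \<in> \<H> \<and> \<zeta> \<in> \<H> \<and>
    (\<exists>\<omega>. (\<forall>n. \<omega> n \<in> Fin) \<and>
      (\<lambda>n. ip (\<lambda>\<sigma>. \<omega> n \<sigma> - \<eta> \<sigma>) (\<lambda>\<sigma>. \<omega> n \<sigma> - \<eta> \<sigma>)) \<longlonglongrightarrow> 0 \<and>
      (\<lambda>n. ip (\<lambda>\<sigma>. T (\<omega> n) \<sigma> - \<zeta> \<sigma>) (\<lambda>\<sigma>. T (\<omega> n) \<sigma> - \<zeta> \<sigma>)) \<longlonglongrightarrow> 0)" (is "?L \<longleftrightarrow> ?R")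
proof
  assume ?L
  then obtain s where s: "\<eta> \<in> \<H>" "\<zeta> \<in> \<H>" "\<And>n. s n \<in> Gr"
      "(\<lambda>n. ip (\<lambda>\<sigma>. fst (s n) \<sigma> - \<eta> \<sigma>) (\<lambda>\<sigma>. fst (s n) \<sigma> - \<eta> \<sigma>)) \<longlonglongrightarrow> 0"
      "(\<lambda>n. ip (\<lambda>\<sigma>. snd (s n) \<sigma> - \<zeta> \<sigma>) (\<lambda>\<sigma>. snd (s n) \<sigma> - \<zeta> \<sigma>)) \<longlonglongrightarrow> 0"
    unfolding l2_closure_def l2_norm_tendsto_0_iff by auto
  have "fst (s n) \<in> Fin" "snd (s n) = T (fst (s n))" for n
    using s(3)[of n] by (auto simp: operator_graph_def)
  with s show ?R by (auto intro!: exI[of _ "\<lambda>n. fst (s n)"])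
next
  assume ?R
  then obtain \<omega> where \<omega>: "\<eta> \<in> \<H>" "\<zeta> \<in> \<H>" "\<And>n. \<omega> n \<in> Fin"
      "(\<lambda>n. ip (\<lambda>\<sigma>. \<omega> n \<sigma> - \<eta> \<sigma>) (\<lambda>\<sigma>. \<omega> n \<sigma> - \<eta> \<sigma>)) \<longlonglongrightarrow> 0"
      "(\<lambda>n. ip (\<lambda>\<sigma>. T (\<omega> n) \<sigma> - \<zeta> \<sigma>) (\<lambda>\<sigma>. T (\<omega> n) \<sigma> - \<zeta> \<sigma>)) \<longlonglongrightarrow> 0"
    by blast
  then show ?L
    unfolding l2_closure_def l2_norm_tendsto_0_iff
    by (auto simp: operator_graph_def intro!: exI[of _ "\<lambda>n. (\<omega> n, T (\<omega> n))"])
qed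

text \<open>
  A minimising sequence for the distance of \<open>f\<close> to the range of \<open>l + T\<close> converges in the graph
  norm of \<open>T\<close>, and the residual is orthogonal to that range.
\<close>

lemma closure_shifted_surj:
  assumes f: "f \<in> \<H>"
  obtains x y where "(x, y) \<in> l2_closure S m Gr" "f = (\<lambda>\<sigma>. l * x \<sigma> + 1 * y \<sigma>)"
proof -
  define r where "r \<omega> = (\<lambda>\<sigma>. f \<sigma> - shifted \<omega> \<sigma>)" for \<omega>
  define J where "J \<omega> = ip (r \<omega>) (r \<omega>)" for \<omega>
  define d where "d = (INF \<omega>\<in>Fin. J \<omega>)"
  define e :: "nat \<Rightarrow> real" where "e n = 1 / real (Suc n)" for n
  have e_pos: "e n > 0" for n by (simp add: e_def)
  have e_lim: "e \<longlonglongrightarrow> 0"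
    unfolding e_def using LIMSEQ_inverse_real_of_nat by (simp add: inverse_eq_divide)
  have r: "r \<omega> \<in> \<H>" if "\<omega> \<in> Fin" for \<omega>
    unfolding r_def by (intro l2_diff f shifted_l2 that)
  have zero_Fin: "(\<lambda>_. 0) \<in> Fin" by (simp add: finite_cochains_def cochains_def)
  have bdd: "bdd_below (J ` Fin)"
    by (rule bdd_belowI[of _ 0]) (auto simp: J_def ip_nonneg)
  have d_le: "d \<le> J \<omega>" if "\<omega> \<in> Fin" for \<omega>
    unfolding d_def by (rule cINF_lower[OF bdd that])
  have "\<exists>\<omega>\<in>Fin. J \<omega> < d + e n" for n
    using cINF_less_iff[of Fin J "d + e n"] bdd zero_Fin e_pos[of n] by (auto simp: d_def)
  then obtain \<omega> where \<omega>: "\<And>n. \<omega> n \<in> Fin" and J\<omega>: "\<And>n. J (\<omega> n) < d + e n"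
    by metis
  have comb_diff: "(\<lambda>\<sigma>. 1 * \<omega> i \<sigma> + (-1) * \<omega> j \<sigma>) \<in> Fin" for i j
    by (intro finite_cochain_lincomb \<omega>)
  have Cauchy: "ip (shifted (\<lambda>\<sigma>. 1 * \<omega> i \<sigma> + (-1) * \<omega> j \<sigma>)) (shifted (\<lambda>\<sigma>. 1 * \<omega> i \<sigma> + (-1) * \<omega> j \<sigma>))
      \<le> 2 * e i + 2 * e j" for i j
  proof -
    let ?u = "r (\<omega> i)" and ?v = "r (\<omega> j)"
    \<comment> \<open>Parallelogram identity: the midpoint of two competitors is again a competitor,
      so its squared residual is at least \<open>d\<close>, whereas those of the end points exceed
      \<open>d\<close> by less than \<open>e i\<close> and \<open>e j\<close>.\<close>
    have "r (\<lambda>\<sigma>. 1/2 * \<omega> i \<sigma> + 1/2 * \<omega> j \<sigma>) = (\<lambda>\<sigma>. 1/2 * ?u \<sigma> + 1/2 * ?v \<sigma>)"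
      unfolding r_def shifted_linear[OF \<omega> \<omega>] by (simp add: fun_eq_iff field_simps)
    then have mid: "d \<le> (1/2)\<^sup>2 * ip ?u ?u + 2 * (1/2) * (1/2) * ip ?u ?v + (1/2)\<^sup>2 * ip ?v ?v"
      using d_le[OF finite_cochain_lincomb[OF \<omega> \<omega>], of "1/2" i "1/2" j]
        ip_lincomb_square[OF r[OF \<omega>] r[OF \<omega>], of "1/2" i "1/2" j]
      by (simp add: J_def)
    have "shifted (\<lambda>\<sigma>. 1 * \<omega> i \<sigma> + (-1) * \<omega> j \<sigma>) = (\<lambda>\<sigma>. ?v \<sigma> - ?u \<sigma>)"
      unfolding r_def shifted_linear[OF \<omega> \<omega>] by (simp add: fun_eq_iff)
    then show ?thesis
      using mid ip_diff_square[OF r[OF \<omega>] r[OF \<omega>], of j i] J\<omega>[of i] J\<omega>[of j]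
      by (simp add: J_def power2_eq_square ip_commute[of ?v ?u])
  qed
  have "ip (\<lambda>\<sigma>. \<omega> i \<sigma> - \<omega> j \<sigma>) (\<lambda>\<sigma>. \<omega> i \<sigma> - \<omega> j \<sigma>) \<le> 2 / l\<^sup>2 * e i + 2 / l\<^sup>2 * e j" for i j
  proof -
    have "l\<^sup>2 * ip (\<lambda>\<sigma>. \<omega> i \<sigma> - \<omega> j \<sigma>) (\<lambda>\<sigma>. \<omega> i \<sigma> - \<omega> j \<sigma>) \<le> 2 * e i + 2 * e j"
      using order_trans[OF shifted_square_ge(1)[OF comb_diff] Cauchy] by simp
    then show ?thesis
      using l_pos by (simp add: field_simps)
  qed
  moreover have "(\<lambda>n. 2 / l\<^sup>2 * e n) \<longlonglongrightarrow> 0"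
    by (rule tendsto_mult_right_zero[OF e_lim])
  ultimately obtain x where x: "x \<in> \<H>"
    and x_lim: "(\<lambda>n. ip (\<lambda>\<sigma>. \<omega> n \<sigma> - x \<sigma>) (\<lambda>\<sigma>. \<omega> n \<sigma> - x \<sigma>)) \<longlonglongrightarrow> 0"
    using l2_complete[of \<omega> "\<lambda>n. 2 / l\<^sup>2 * e n"] finite_cochain_l2[OF \<omega>] by blast
  have "ip (\<lambda>\<sigma>. T (\<omega> i) \<sigma> - T (\<omega> j) \<sigma>) (\<lambda>\<sigma>. T (\<omega> i) \<sigma> - T (\<omega> j) \<sigma>) \<le> 2 * e i + 2 * e j" for i j
    using order_trans[OF shifted_square_ge(2)[OF comb_diff] Cauchy, of i j]
    unfolding linear[OF \<omega> \<omega>] by simp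
  moreover have "(\<lambda>n. 2 * e n) \<longlonglongrightarrow> 0"
    by (rule tendsto_mult_right_zero[OF e_lim])
  ultimately obtain y where y: "y \<in> \<H>"
    and y_lim: "(\<lambda>n. ip (\<lambda>\<sigma>. T (\<omega> n) \<sigma> - y \<sigma>) (\<lambda>\<sigma>. T (\<omega> n) \<sigma> - y \<sigma>)) \<longlonglongrightarrow> 0"
    using l2_complete[of "\<lambda>n. T (\<omega> n)" "\<lambda>n. 2 * e n"] maps[OF \<omega>] by blast
  let ?p = "\<lambda>\<sigma>. l * x \<sigma> + 1 * y \<sigma>"
  let ?g = "\<lambda>\<sigma>. f \<sigma> - ?p \<sigma>"
  have p: "?p \<in> \<H>" by (intro l2_lincomb x y)
  have g: "?g \<in> \<H>" by (intro l2_diff f p)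
  have orth: "ip (shifted c) ?g = 0" if c: "c \<in> Fin" for c
  proof -
    let ?h = "shifted c"
    note h = shifted_l2[OF c]
    have "(\<lambda>n. ip f ?h - (l * ip (\<omega> n) ?h + ip (T (\<omega> n)) ?h)) \<longlonglongrightarrow> ip f ?h - (l * ip x ?h + ip y ?h)"
      by (intro tendsto_diff tendsto_add tendsto_mult_left tendsto_const
          ip_tendsto[OF finite_cochain_l2[OF \<omega>] x h x_lim] ip_tendsto[OF maps[OF \<omega>] y h y_lim])
    moreover have "ip (r (\<omega> n)) ?h = ip f ?h - (l * ip (\<omega> n) ?h + ip (T (\<omega> n)) ?h)" for n
      unfolding r_def ip_diff_left[OF f shifted_l2[OF \<omega>] h] ip_shifted[OF \<omega> h] ..
    moreover have "ip ?g ?h = ip f ?h - (l * ip x ?h + ip y ?h)"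
      unfolding ip_diff_left[OF f p h] ip_lincomb_left[OF x y h] by simp
    ultimately have lim: "(\<lambda>n. ip (r (\<omega> n)) ?h) \<longlonglongrightarrow> ip ?g ?h" by simp
    \<comment> \<open>Moving \<omega> n to \<omega> n + t c changes the squared residual by
      \<open>t\<^sup>2 * ip ?h ?h - 2 * t * ip (r (\<omega> n)) ?h\<close>. Near-minimality bounds
      this change below by \<open>- e n\<close>, which vanishes in the limit.\<close>
    have variation: "2 * t * ip ?g ?h \<le> t\<^sup>2 * ip ?h ?h" for t
    proof (rule tendsto_le[OF sequentially_bot])
      show "(\<lambda>n. 2 * t * ip (r (\<omega> n)) ?h) \<longlonglongrightarrow> 2 * t * ip ?g ?h"
        by (intro tendsto_mult_left lim)
      show "(\<lambda>n. t\<^sup>2 * ip ?h ?h + e n) \<longlonglongrightarrow> t\<^sup>2 * ip ?h ?h"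
        using tendsto_add[OF tendsto_const e_lim] by simp
      have "2 * t * ip (r (\<omega> n)) ?h \<le> t\<^sup>2 * ip ?h ?h + e n" for n
      proof -
        have "r (\<lambda>\<sigma>. 1 * \<omega> n \<sigma> + t * c \<sigma>) = (\<lambda>\<sigma>. 1 * r (\<omega> n) \<sigma> + (- t) * ?h \<sigma>)"
          unfolding r_def shifted_linear[OF \<omega> c] by (simp add: fun_eq_iff)
        then have "d \<le> ip (r (\<omega> n)) (r (\<omega> n)) - 2 * t * ip (r (\<omega> n)) ?h + t\<^sup>2 * ip ?h ?h"
          using d_le[OF finite_cochain_lincomb[OF \<omega> c], of 1 n t]
            ip_lincomb_square[OF r[OF \<omega>] h, of 1 n "- t"]
          by (simp add: J_def)
        then show ?thesis
          using J\<omega>[of n] by (simp add: J_def)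
      qed
      then show "\<forall>\<^sub>F n in sequentially. 2 * t * ip (r (\<omega> n)) ?h \<le> t\<^sup>2 * ip ?h ?h + e n"
        by simp
    qed
    define k Q where "k = ip ?g ?h" and "Q = ip ?h ?h"
    have Q: "Q \<ge> 0" by (simp add: Q_def ip_nonneg)
    \<comment> \<open>The best parameter would be \<open>k / Q\<close>; the \<open>+ 1\<close> keeps
      the denominator positive when \<open>Q = 0\<close> and still forces
      \<open>k = 0\<close>.\<close>
    have "2 * (k / (Q + 1)) * k \<le> (k / (Q + 1))\<^sup>2 * Q"
      using variation[of "k / (Q + 1)"] by (simp add: k_def Q_def)
    then have "2 * k\<^sup>2 * (Q + 1) \<le> k\<^sup>2 * Q"
      using Q by (simp add: divide_simps power2_eq_square split: if_splits)
    then have "k\<^sup>2 * (Q + 2) \<le> 0"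
      by (simp add: algebra_simps)
    then have "k = 0"
      using Q by (simp add: mult_le_0_iff)
    then show ?thesis
      by (simp add: k_def ip_commute)
  qed
  \<comment> \<open>Orthogonality to the range of \<open>l + T\<close> is precisely the weak
    equation ruled out by \<open>deficiency\<close>.\<close>
  have "ip (T c) ?g = - l * ip c ?g" if "c \<in> Fin" for c
    using orth[OF that] unfolding ip_shifted[OF that g] by simp
  then have "?g = (\<lambda>_. 0)"
    by (rule deficiency[OF g])
  then have "f = ?p" by (simp add: fun_eq_iff)
  moreover have "(x, y) \<in> l2_closure S m Gr"
    unfolding closure_iff using x y \<omega> x_lim y_lim by blast
  ultimately show ?thesis using that by blast
qed

lemma graph_subset_closure: "Gr \<subseteq> l2_closure S m Gr"
proof
  fix z
  assume "z \<in> Gr"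
  then obtain \<omega> where "\<omega> \<in> Fin" "z = (\<omega>, T \<omega>)"
    by (auto simp: operator_graph_def)
  then show "z \<in> l2_closure S m Gr"
    using finite_cochain_l2 maps
    by (auto simp: closure_iff l2_inner_def intro!: exI[of _ "\<lambda>_. \<omega>"])
qed

text \<open>The numbers \<open>ip (T (\<omega> n)) x\<close> equal \<open>ip (\<omega> n) y\<close>
  and so have both sides as limits. Allowing any adjoint pair, not only graph elements, lets the
  same identity show that the closure lies in the adjoint and then that it lies in its own
  adjoint.\<close>

lemma closure_symmetric:
  assumes "(\<eta>, \<zeta>) \<in> l2_closure S m Gr" "(x, y) \<in> l2_adjoint S m Gr"
  shows "ip \<zeta> x = ip \<eta> y"
proof -
  obtain \<omega> where \<omega>: "\<eta> \<in> \<H>" "\<zeta> \<in> \<H>" "\<And>n. \<omega> n \<in> Fin"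
      "(\<lambda>n. ip (\<lambda>\<sigma>. \<omega> n \<sigma> - \<eta> \<sigma>) (\<lambda>\<sigma>. \<omega> n \<sigma> - \<eta> \<sigma>)) \<longlonglongrightarrow> 0"
      "(\<lambda>n. ip (\<lambda>\<sigma>. T (\<omega> n) \<sigma> - \<zeta> \<sigma>) (\<lambda>\<sigma>. T (\<omega> n) \<sigma> - \<zeta> \<sigma>)) \<longlonglongrightarrow> 0"
    using assms(1) unfolding closure_iff by blast
  have xy: "x \<in> \<H>" "y \<in> \<H>" "\<And>\<omega>. \<omega> \<in> Fin \<Longrightarrow> ip (T \<omega>) x = ip \<omega> y"
    using assms(2) unfolding adjoint_iff by auto
  have "(\<lambda>n. ip (T (\<omega> n)) x) \<longlonglongrightarrow> ip \<zeta> x"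
    by (rule ip_tendsto[OF maps[OF \<omega>(3)] \<omega>(2) xy(1) \<omega>(5)])
  moreover have "(\<lambda>n. ip (T (\<omega> n)) x) \<longlonglongrightarrow> ip \<eta> y"
    unfolding xy(3)[OF \<omega>(3)]
    by (rule ip_tendsto[OF finite_cochain_l2[OF \<omega>(3)] \<omega>(1) xy(2) \<omega>(4)])
  ultimately show ?thesis by (rule LIMSEQ_unique)
qed

lemma graph_subset_adjoint: "Gr \<subseteq> l2_adjoint S m Gr"
  using maps finite_cochain_l2 symmetric by (auto simp: l2_adjoint_def operator_graph_def)

lemma closure_subset_adjoint: "l2_closure S m Gr \<subseteq> l2_adjoint S m Gr"
proof safe
  fix \<eta> \<zeta>
  assume *: "(\<eta>, \<zeta>) \<in> l2_closure S m Gr"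
  have "ip (T \<omega>) \<eta> = ip \<omega> \<zeta>" if "\<omega> \<in> Fin" for \<omega>
  proof -
    have "(\<omega>, T \<omega>) \<in> l2_adjoint S m Gr"
      using graph_subset_adjoint that by (auto simp: operator_graph_def)
    from closure_symmetric[OF * this] show ?thesis
      by (simp add: ip_commute[of \<eta>] ip_commute[of \<zeta>])
  qed
  with * show "(\<eta>, \<zeta>) \<in> l2_adjoint S m Gr"
    by (auto simp: adjoint_iff l2_closure_def)
qed

text \<open>Surjectivity of \<open>l\<close> plus the closure supplies a closure element with the
  same image as the given adjoint element. Their difference belongs to the adjoint with eigenvalue
  \<open>- l\<close>, hence is zero.\<close>

lemma adjoint_subset_closure: "l2_adjoint S m Gr \<subseteq> l2_closure S m Gr"
proof safe
  fix \<eta> \<zeta>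
  assume *: "(\<eta>, \<zeta>) \<in> l2_adjoint S m Gr"
  then have \<eta>\<zeta>: "\<eta> \<in> \<H>" "\<zeta> \<in> \<H>" "\<And>\<omega>. \<omega> \<in> Fin \<Longrightarrow> ip (T \<omega>) \<eta> = ip \<omega> \<zeta>"
    unfolding adjoint_iff by auto
  let ?f = "\<lambda>\<sigma>. l * \<eta> \<sigma> + 1 * \<zeta> \<sigma>"
  have "?f \<in> \<H>" by (intro l2_lincomb \<eta>\<zeta>)
  then obtain x y where xy: "(x, y) \<in> l2_closure S m Gr"
    and f: "?f = (\<lambda>\<sigma>. l * x \<sigma> + 1 * y \<sigma>)"
    by (rule closure_shifted_surj)
  then have x: "x \<in> \<H>"
    unfolding closure_iff by blast
  have adj: "ip (T c) x = ip c y" if "c \<in> Fin" for c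
    using subsetD[OF closure_subset_adjoint xy] that unfolding adjoint_iff by blast
  have y_eq: "y = (\<lambda>\<sigma>. \<zeta> \<sigma> + l * (\<eta> \<sigma> - x \<sigma>))"
    using f by (simp add: fun_eq_iff algebra_simps)
  have "(\<lambda>\<sigma>. \<eta> \<sigma> - x \<sigma>) = (\<lambda>_. 0)"
  proof (rule deficiency)
    show D: "(\<lambda>\<sigma>. \<eta> \<sigma> - x \<sigma>) \<in> \<H>" by (intro l2_diff \<eta>\<zeta> x)
    fix c
    assume c: "c \<in> Fin"
    note cH = finite_cochain_l2[OF c]
    have "ip (T c) (\<lambda>\<sigma>. \<eta> \<sigma> - x \<sigma>) = ip (T c) \<eta> - ip (T c) x"
      using ip_diff_left[OF \<eta>\<zeta>(1) x maps[OF c]] by (simp add: ip_commute[of "T c"])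
    also have "\<dots> = ip \<zeta> c - ip y c"
      by (simp add: \<eta>\<zeta>(3)[OF c] adj[OF c] ip_commute[of c])
    also have "ip y c = ip \<zeta> c + l * ip (\<lambda>\<sigma>. \<eta> \<sigma> - x \<sigma>) c"
      unfolding y_eq using ip_lincomb_left[OF \<eta>\<zeta>(2) D cH, of 1 l] by simp
    finally show "ip (T c) (\<lambda>\<sigma>. \<eta> \<sigma> - x \<sigma>) = - l * ip c (\<lambda>\<sigma>. \<eta> \<sigma> - x \<sigma>)"
      by (simp add: ip_commute[of c])
  qed
  then have "\<eta> = x" "\<zeta> = y"
    by (simp_all add: y_eq fun_eq_iff)
  with xy show "(\<eta>, \<zeta>) \<in> l2_closure S m Gr" by simp
qed

lemma closure_eq_adjoint: "l2_closure S m Gr = l2_adjoint S m Gr"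
  using closure_subset_adjoint adjoint_subset_closure by blast

text \<open>Linearity and single-valuedness are read off the defining identity of the adjoint and
  then hold for the closure, since the two graphs coincide; this contains closability.\<close>

lemma adjoint_operator: "l2_operator S m (l2_adjoint S m Gr)"
  unfolding l2_operator_def
proof (intro conjI)
  show "l2_adjoint S m Gr \<subseteq> \<H> \<times> \<H>"
    by (auto simp: l2_adjoint_def)
  show "single_valued (l2_adjoint S m Gr)"
    by (rule single_valuedI) (metis adjoint_iff eq_if_ip_eq)
  show "((\<lambda>_. 0), (\<lambda>_. 0)) \<in> l2_adjoint S m Gr"
    by (simp add: adjoint_iff l2_inner_def)
  have "((\<lambda>\<sigma>. a * \<omega> \<sigma> + b * \<eta> \<sigma>), (\<lambda>\<sigma>. a * \<xi> \<sigma> + b * \<zeta> \<sigma>)) \<in> l2_adjoint S m Gr"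
    if "(\<omega>, \<xi>) \<in> l2_adjoint S m Gr" "(\<eta>, \<zeta>) \<in> l2_adjoint S m Gr" for \<omega> \<xi> \<eta> \<zeta> a b
  proof -
    have H: "\<omega> \<in> \<H>" "\<xi> \<in> \<H>" "\<eta> \<in> \<H>" "\<zeta> \<in> \<H>"
      and eq: "\<And>c. c \<in> Fin \<Longrightarrow> ip \<omega> (T c) = ip \<xi> c" "\<And>c. c \<in> Fin \<Longrightarrow> ip \<eta> (T c) = ip \<zeta> c"
      using that ip_commute unfolding adjoint_iff by metis+
    have "ip (\<lambda>\<sigma>. a * \<omega> \<sigma> + b * \<eta> \<sigma>) (T c) = ip (\<lambda>\<sigma>. a * \<xi> \<sigma> + b * \<zeta> \<sigma>) c" if "c \<in> Fin" for c
      using that H by (simp add: ip_lincomb_left maps finite_cochain_l2 eq)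
    then show ?thesis
      using H unfolding adjoint_iff by (auto simp: ip_commute[of "T _"] ip_commute[of _ "\<lambda>\<sigma>. a * \<xi> \<sigma> + b * \<zeta> \<sigma>"] intro: l2_lincomb)
  qed
  then show "\<forall>(\<omega>, \<xi>)\<in>l2_adjoint S m Gr. \<forall>(\<eta>, \<zeta>)\<in>l2_adjoint S m Gr. \<forall>a b.
      ((\<lambda>\<sigma>. a * \<omega> \<sigma> + b * \<eta> \<sigma>), (\<lambda>\<sigma>. a * \<xi> \<sigma> + b * \<zeta> \<sigma>)) \<in> l2_adjoint S m Gr"
    by blast
qed

lemma graph_operator: "l2_operator S m Gr"
  unfolding l2_operator_def
proof (intro conjI)
  show "Gr \<subseteq> \<H> \<times> \<H>"
    using finite_cochain_l2 maps by (auto simp: operator_graph_def)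
  show "single_valued Gr"
    by (auto simp: single_valued_def operator_graph_def)
  have zero: "(\<lambda>_. 0) \<in> Fin"
    by (simp add: finite_cochains_def cochains_def)
  moreover have "T (\<lambda>_. 0) = (\<lambda>_. 0)"
    using linear[OF zero zero, of 0 0] by simp
  ultimately show "((\<lambda>_. 0), (\<lambda>_. 0)) \<in> Gr"
    by (force simp: operator_graph_def)
  show "\<forall>(\<omega>, \<xi>)\<in>Gr. \<forall>(\<eta>, \<zeta>)\<in>Gr. \<forall>a b.
      ((\<lambda>\<sigma>. a * \<omega> \<sigma> + b * \<eta> \<sigma>), (\<lambda>\<sigma>. a * \<xi> \<sigma> + b * \<zeta> \<sigma>)) \<in> Gr"
    using finite_cochain_lincomb linear by (auto simp: operator_graph_def)
qed

text \<open>Passing to adjoints reverses inclusions, so the adjoint of the closure lies in the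
  adjoint of the graph, which is the closure; the other inclusion is symmetry of the
  closure.\<close>

lemma essentially_self_adjoint: "l2_essentially_self_adjoint S m Gr"
proof -
  have dense: "\<exists>\<omega>\<in>Domain Gr. l2_norm S m (\<lambda>\<sigma>. \<eta> \<sigma> - \<omega> \<sigma>) < e" if "\<eta> \<in> \<H>" "e > 0" for \<eta> e
  proof -
    obtain \<omega> where "\<omega> \<in> Fin" "l2_norm S m (\<lambda>\<sigma>. \<eta> \<sigma> - \<omega> \<sigma>) < e"
      using finite_cochains_dense[OF \<open>\<eta> \<in> \<H>\<close> \<open>e > 0\<close>] by blast
    moreover from this have "\<omega> \<in> Domain Gr"
      by (auto simp: operator_graph_def)
    ultimately show ?thesis by blast
  qed
  have "l2_adjoint S m (l2_closure S m Gr) = l2_closure S m Gr"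
  proof
    have "l2_adjoint S m (l2_closure S m Gr) \<subseteq> l2_adjoint S m Gr"
      using graph_subset_closure unfolding l2_adjoint_def by blast
    then show "l2_adjoint S m (l2_closure S m Gr) \<subseteq> l2_closure S m Gr"
      using adjoint_subset_closure by blast
    show "l2_closure S m Gr \<subseteq> l2_adjoint S m (l2_closure S m Gr)"
    proof safe
      fix x y
      assume *: "(x, y) \<in> l2_closure S m Gr"
      then have "x \<in> \<H>" "y \<in> \<H>" unfolding closure_iff by blast+
      then show "(x, y) \<in> l2_adjoint S m (l2_closure S m Gr)"
        using closure_symmetric[OF _ subsetD[OF closure_subset_adjoint *]]
        by (auto simp: l2_adjoint_def[of _ _ "l2_closure S m Gr"])
    qed
  qed
  moreover have "l2_operator S m (l2_closure S m Gr)"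
    unfolding closure_eq_adjoint by (rule adjoint_operator)
  moreover have "l2_densely_defined S m (l2_closure S m Gr)"
    using dense Domain_mono[OF graph_subset_closure]
    unfolding l2_densely_defined_def by blast
  ultimately show ?thesis
    using dense graph_operator
    by (simp add: l2_essentially_self_adjoint_def l2_self_adjoint_def l2_densely_defined_def)
qed

end


section \<open>Coboundary and boundary on a locally finite complex\<close>

lemma covered_by_iff: "covered_by \<tau> \<sigma> \<longleftrightarrow> (\<exists>v. v \<notin> \<tau> \<and> \<sigma> = insert v \<tau>)"
proof
  assume "covered_by \<tau> \<sigma>"
  then obtain v where "\<sigma> - \<tau> = {v}" "\<tau> \<subseteq> \<sigma>"
    by (auto simp: covered_by_def card_1_singleton_iff)
  then have "v \<notin> \<tau>" "\<sigma> = insert v \<tau>" by blast+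
  then show "\<exists>v. v \<notin> \<tau> \<and> \<sigma> = insert v \<tau>" by blast
next
  assume "\<exists>v. v \<notin> \<tau> \<and> \<sigma> = insert v \<tau>"
  then obtain v where "v \<notin> \<tau>" "\<sigma> = insert v \<tau>" by blast
  then have "\<sigma> - \<tau> = {v}" "\<tau> \<subseteq> \<sigma>" by blast+
  then show "covered_by \<tau> \<sigma>" by (simp add: covered_by_def)
qed

text \<open>Distinct facets of \<sigma> omit different vertices, and their intersection omits
  exactly these two.\<close>

lemma covered_by_inter:
  assumes "covered_by \<tau> \<sigma>" "covered_by \<tau>' \<sigma>" "\<tau>' \<noteq> \<tau>"
  shows "covered_by (\<tau> \<inter> \<tau>') \<tau>" "covered_by (\<tau> \<inter> \<tau>') \<tau>'"
proof -
  obtain u v where *: "v \<notin> \<tau>" "\<sigma> = insert v \<tau>" "u \<notin> \<tau>'" "\<sigma> = insert u \<tau>'"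
    using assms by (auto simp: covered_by_iff)
  have \<tau>: "\<tau> = \<sigma> - {v}" and "v \<in> \<sigma>"
    using *(1,2) by auto
  have \<tau>': "\<tau>' = \<sigma> - {u}" and "u \<in> \<sigma>"
    using *(3,4) by auto
  have "u \<noteq> v" using assms(3) \<tau> \<tau>' by auto
  with \<open>u \<in> \<sigma>\<close> \<open>v \<in> \<sigma>\<close>
  have "u \<notin> \<tau> \<inter> \<tau>'" "\<tau> = insert u (\<tau> \<inter> \<tau>')" "v \<notin> \<tau> \<inter> \<tau>'" "\<tau>' = insert v (\<tau> \<inter> \<tau>')"
    unfolding \<tau> \<tau>' by auto
  then show "covered_by (\<tau> \<inter> \<tau>') \<tau>" "covered_by (\<tau> \<inter> \<tau>') \<tau>'"
    unfolding covered_by_iff by blast+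
qed

text \<open>The common face is determined by the pair, so organising neighbours by common faces
  counts none of them twice.\<close>

lemma covered_by_unique_inter:
  assumes "covered_by \<rho> \<tau>" "covered_by \<rho> \<tau>'" "\<tau>' \<noteq> \<tau>"
  shows "\<rho> = \<tau> \<inter> \<tau>'"
proof -
  obtain u v where "u \<notin> \<rho>" "\<tau> = insert u \<rho>" "v \<notin> \<rho>" "\<tau>' = insert v \<rho>"
    using assms by (auto simp: covered_by_iff)
  with assms(3) show ?thesis by blast
qed

text \<open>\<sigma> has exactly two vertices more than \<rho>, and an intermediate simplex is a
  choice of which one is added first.\<close>

lemma covered_by_diamond:
  assumes "covered_by \<rho> \<tau>" "covered_by \<rho> \<tau>'" "covered_by \<tau> \<sigma>" "covered_by \<tau>' \<sigma>" "\<tau>' \<noteq> \<tau>"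
  shows "covered_by \<rho> \<tau>'' \<and> covered_by \<tau>'' \<sigma> \<longleftrightarrow> \<tau>'' = \<tau> \<or> \<tau>'' = \<tau>'"
proof -
  obtain a where a: "a \<notin> \<rho>" "\<tau> = insert a \<rho>"
    using assms(1) by (auto simp: covered_by_iff)
  obtain b where b: "b \<notin> \<rho>" "\<tau>' = insert b \<rho>"
    using assms(2) by (auto simp: covered_by_iff)
  obtain u where u: "u \<notin> \<tau>" "\<sigma> = insert u \<tau>"
    using assms(3) by (auto simp: covered_by_iff)
  have "b \<in> \<sigma>" using assms(4) b by (auto simp: covered_by_def)
  with a b u assms(5) have \<sigma>: "\<sigma> = insert a (insert b \<rho>)" by blast
  have "\<tau>'' = \<tau> \<or> \<tau>'' = \<tau>'" if "covered_by \<rho> \<tau>''" "covered_by \<tau>'' \<sigma>"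
  proof -
    obtain x where x: "x \<notin> \<rho>" "\<tau>'' = insert x \<rho>"
      using \<open>covered_by \<rho> \<tau>''\<close> by (auto simp: covered_by_iff)
    have "x \<in> \<sigma>" using that(2) x by (auto simp: covered_by_def)
    with x \<sigma> a b show ?thesis by blast
  qed
  with assms show ?thesis by blast
qed

text \<open>\<open>face_closed\<close> speaks of nonempty faces because \<open>{}\<close> may have
  been removed from \<open>S\<close>. Finiteness of cofaces turns the infinite sums of the boundary
  and of the curvature into finite ones.\<close>

locale locally_finite_complex = weighted_l2 S m
  for S :: "'v set set" and m +
  fixes \<delta> :: "('v set \<Rightarrow> real) \<Rightarrow> 'v set \<Rightarrow> real"
  assumes finite_simplex: "\<sigma> \<in> S \<Longrightarrow> finite \<sigma>"
    and face_closed: "\<sigma> \<in> S \<Longrightarrow> \<rho> \<subseteq> \<sigma> \<Longrightarrow> \<rho> \<noteq> {} \<Longrightarrow> \<rho> \<in> S"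
    and finite_cofaces: "\<tau> \<in> S \<Longrightarrow> finite (cofaces_above S \<tau>)"
    and coboundary: "coboundary_operator S \<delta>"
begin

abbreviation "\<theta> \<equiv> incidence \<delta>"
abbreviation "bd \<equiv> boundary_operator S m \<delta>"
abbreviation "C \<equiv> cochains S"

section \<open>Pointwise rules for the coboundary and the boundary\<close>

lemma finite_faces: "\<sigma> \<in> S \<Longrightarrow> finite (faces_below S \<sigma>)"
  by (rule finite_subset[of _ "Pow \<sigma>"])
    (auto simp: faces_below_def covered_by_def finite_simplex)

lemma coboundary_cochain: "\<omega> \<in> C \<Longrightarrow> \<delta> \<omega> \<in> C"
  using coboundary by (simp add: coboundary_operator_def)

lemma coboundary_linear:
  "\<omega> \<in> C \<Longrightarrow> \<eta> \<in> C \<Longrightarrow> \<delta> (\<lambda>\<sigma>. a * \<omega> \<sigma> + b * \<eta> \<sigma>) = (\<lambda>\<sigma>. a * \<delta> \<omega> \<sigma> + b * \<delta> \<eta> \<sigma>)"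
  using coboundary by (simp add: coboundary_operator_def)

lemma coboundary_coboundary: "\<omega> \<in> C \<Longrightarrow> \<delta> (\<delta> \<omega>) = (\<lambda>_. 0)"
  using coboundary by (simp add: coboundary_operator_def)

lemma coboundary_zero: "\<delta> (\<lambda>_. 0) = (\<lambda>_. 0)"
  using coboundary_linear[of "\<lambda>_. 0" "\<lambda>_. 0" 0 0] by (simp add: cochains_def)

lemma coboundary_eq:
  "\<omega> \<in> C \<Longrightarrow> \<sigma> \<in> S \<Longrightarrow> \<delta> \<omega> \<sigma> = (\<Sum>\<tau>\<in>faces_below S \<sigma>. \<omega> \<tau> * \<theta> \<tau> \<sigma>)"
  using coboundary by (simp add: coboundary_operator_def)

lemma incidence_eq_0: "\<tau> \<in> S \<Longrightarrow> \<sigma> \<in> S \<Longrightarrow> \<not> covered_by \<tau> \<sigma> \<Longrightarrow> \<theta> \<tau> \<sigma> = 0"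
  using coboundary by (auto simp: coboundary_operator_def)

lemma incidence_cases:
  assumes "\<tau> \<in> S" "\<sigma> \<in> S" "covered_by \<tau> \<sigma>"
  shows "\<theta> \<tau> \<sigma> = 1 \<or> \<theta> \<tau> \<sigma> = -1"
proof -
  have "\<theta> \<tau> \<sigma> \<in> {-1, 0, 1}" "\<theta> \<tau> \<sigma> \<noteq> 0"
    using coboundary assms unfolding coboundary_operator_def by blast+
  then show ?thesis by blast
qed

lemma boundary_cochain: "bd \<omega> \<in> C"
  by (simp add: boundary_operator_def cochains_def)

lemma boundary_eq:
  "\<rho> \<in> S \<Longrightarrow> m \<rho> * bd \<omega> \<rho> = (\<Sum>\<tau>\<in>cofaces_above S \<rho>. m \<tau> * \<omega> \<tau> * \<theta> \<rho> \<tau>)"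
  using weight_pos[of \<rho>] finite_cofaces[of \<rho>] by (simp add: boundary_operator_def)

lemma boundary_linear:
  "bd (\<lambda>\<sigma>. a * \<omega> \<sigma> + b * \<eta> \<sigma>) = (\<lambda>\<sigma>. a * bd \<omega> \<sigma> + b * bd \<eta> \<sigma>)"
proof
  fix \<rho>
  show "bd (\<lambda>\<sigma>. a * \<omega> \<sigma> + b * \<eta> \<sigma>) \<rho> = a * bd \<omega> \<rho> + b * bd \<eta> \<rho>"
  proof (cases "\<rho> \<in> S")
    case True
    have "m \<rho> * bd (\<lambda>\<sigma>. a * \<omega> \<sigma> + b * \<eta> \<sigma>) \<rho> = a * (m \<rho> * bd \<omega> \<rho>) + b * (m \<rho> * bd \<eta> \<rho>)"
      unfolding boundary_eq[OF True]
      by (simp add: sum_distrib_left sum.distrib[symmetric] algebra_simps)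
    also have "\<dots> = m \<rho> * (a * bd \<omega> \<rho> + b * bd \<eta> \<rho>)"
      by (simp add: algebra_simps)
    finally show ?thesis
      using weight_pos[OF True] by simp
  qed (simp add: boundary_operator_def)
qed

lemma boundary_zero: "bd (\<lambda>_. 0) = (\<lambda>_. 0)"
  using boundary_linear[of 0 "\<lambda>_. 0" 0 "\<lambda>_. 0"] by simp

section \<open>Preservation of finite support and Green's formulas\<close>

lemma finite_cochain_cochain: "\<omega> \<in> Fin \<Longrightarrow> \<omega> \<in> C"
  by (simp add: finite_cochains_def)

lemma support_subset: "\<omega> \<in> C \<Longrightarrow> {\<sigma>. \<omega> \<sigma> \<noteq> 0} \<subseteq> S"
  by (auto simp: cochains_def)

lemma coboundary_finite:
  assumes "\<omega> \<in> Fin"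
  shows "\<delta> \<omega> \<in> Fin"
proof -
  note \<omega> = finite_cochain_cochain[OF assms]
  have "{\<sigma>. \<delta> \<omega> \<sigma> \<noteq> 0} \<subseteq> (\<Union>\<tau>\<in>{\<tau>. \<omega> \<tau> \<noteq> 0}. cofaces_above S \<tau>)"
  proof
    fix \<sigma>
    assume "\<sigma> \<in> {\<sigma>. \<delta> \<omega> \<sigma> \<noteq> 0}"
    then have nz: "\<delta> \<omega> \<sigma> \<noteq> 0" and \<sigma>: "\<sigma> \<in> S"
      using support_subset[OF coboundary_cochain[OF \<omega>]] by auto
    then obtain \<tau> where "\<tau> \<in> faces_below S \<sigma>" "\<omega> \<tau> * \<theta> \<tau> \<sigma> \<noteq> 0"
      unfolding coboundary_eq[OF \<omega> \<sigma>] by (meson sum.neutral)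
    with \<sigma> show "\<sigma> \<in> (\<Union>\<tau>\<in>{\<tau>. \<omega> \<tau> \<noteq> 0}. cofaces_above S \<tau>)"
      by (auto simp: faces_below_def cofaces_above_def)
  qed
  moreover have "finite (\<Union>\<tau>\<in>{\<tau>. \<omega> \<tau> \<noteq> 0}. cofaces_above S \<tau>)"
    using assms support_subset[OF \<omega>] finite_cofaces by (auto simp: finite_cochains_def)
  ultimately show ?thesis
    using coboundary_cochain[OF \<omega>] by (simp add: finite_cochains_def finite_subset)
qed

lemma boundary_finite:
  assumes "\<omega> \<in> Fin"
  shows "bd \<omega> \<in> Fin"
proof -
  note \<omega> = finite_cochain_cochain[OF assms]
  have "{\<rho>. bd \<omega> \<rho> \<noteq> 0} \<subseteq> (\<Union>\<tau>\<in>{\<tau>. \<omega> \<tau> \<noteq> 0}. faces_below S \<tau>)"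
  proof
    fix \<rho>
    assume "\<rho> \<in> {\<rho>. bd \<omega> \<rho> \<noteq> 0}"
    then have nz: "bd \<omega> \<rho> \<noteq> 0" and \<rho>: "\<rho> \<in> S"
      using support_subset[OF boundary_cochain] by auto
    then have "m \<rho> * bd \<omega> \<rho> \<noteq> 0"
      using weight_pos[OF \<rho>] by simp
    then obtain \<tau> where "\<tau> \<in> cofaces_above S \<rho>" "m \<tau> * \<omega> \<tau> * \<theta> \<rho> \<tau> \<noteq> 0"
      unfolding boundary_eq[OF \<rho>] by (meson sum.neutral)
    with \<rho> show "\<rho> \<in> (\<Union>\<tau>\<in>{\<tau>. \<omega> \<tau> \<noteq> 0}. faces_below S \<tau>)"
      by (auto simp: faces_below_def cofaces_above_def)
  qed
  moreover have "finite (\<Union>\<tau>\<in>{\<tau>. \<omega> \<tau> \<noteq> 0}. faces_below S \<tau>)"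
    using assms support_subset[OF \<omega>] finite_faces by (auto simp: finite_cochains_def)
  ultimately show ?thesis
    using boundary_cochain by (simp add: finite_cochains_def finite_subset)
qed

text \<open>Only incident pairs on which both cochains are nonzero contribute. If these lie in a
  finite product of \<open>A\<close> and \<open>B\<close>, the exchange of summation is finite. This
  common form handles either cochain being the finitely supported one: the other finite set is then
  formed by the neighbours of its support.\<close>

lemma Green_formula:
  assumes \<omega>: "\<omega> \<in> C" and A: "finite A" "A \<subseteq> S" and B: "finite B" "B \<subseteq> S"
    and supp: "\<And>\<tau> \<sigma>. \<tau> \<in> S \<Longrightarrow> \<sigma> \<in> S \<Longrightarrow> covered_by \<tau> \<sigma> \<Longrightarrow> \<omega> \<tau> \<noteq> 0 \<Longrightarrow> \<eta> \<sigma> \<noteq> 0 \<Longrightarrow>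
      \<tau> \<in> A \<and> \<sigma> \<in> B"
  shows "ip (\<delta> \<omega>) \<eta> = ip \<omega> (bd \<eta>)"
proof -
  have vanish: "\<omega> \<tau> * \<theta> \<tau> \<sigma> * \<eta> \<sigma> = 0" if "\<tau> \<in> S" "\<sigma> \<in> S" "\<tau> \<notin> A \<or> \<sigma> \<notin> B" for \<tau> \<sigma>
    using supp[OF that(1,2)] incidence_eq_0[OF that(1,2)] that(3)
    by (cases "covered_by \<tau> \<sigma>") auto
  have left: "\<delta> \<omega> \<sigma> * \<eta> \<sigma> = (\<Sum>\<tau>\<in>A. \<omega> \<tau> * \<theta> \<tau> \<sigma> * \<eta> \<sigma>)" if "\<sigma> \<in> S" for \<sigma>
    unfolding coboundary_eq[OF \<omega> that] sum_distrib_right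
    by (rule sum.mono_neutral_cong[OF A(1) finite_faces[OF that]])
      (use supp that incidence_eq_0 A in \<open>auto simp: faces_below_def\<close>)
  have right: "\<omega> \<tau> * (m \<tau> * bd \<eta> \<tau>) = (\<Sum>\<sigma>\<in>B. m \<sigma> * (\<omega> \<tau> * \<theta> \<tau> \<sigma> * \<eta> \<sigma>))" if \<tau>: "\<tau> \<in> S" for \<tau>
  proof -
    have "\<omega> \<tau> * (m \<tau> * bd \<eta> \<tau>) = (\<Sum>\<sigma>\<in>cofaces_above S \<tau>. m \<sigma> * (\<omega> \<tau> * \<theta> \<tau> \<sigma> * \<eta> \<sigma>))"
      by (simp add: boundary_eq[OF \<tau>] sum_distrib_left mult_ac)
    also have "\<dots> = (\<Sum>\<sigma>\<in>B. m \<sigma> * (\<omega> \<tau> * \<theta> \<tau> \<sigma> * \<eta> \<sigma>))"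
    proof (rule sum.mono_neutral_cong[OF B(1) finite_cofaces[OF \<tau>]])
      fix \<sigma>
      assume "\<sigma> \<in> B - cofaces_above S \<tau>"
      then have "\<theta> \<tau> \<sigma> = 0"
        using B(2) by (intro incidence_eq_0[OF \<tau>]) (auto simp: cofaces_above_def)
      then show "m \<sigma> * (\<omega> \<tau> * \<theta> \<tau> \<sigma> * \<eta> \<sigma>) = 0" by simp
    next
      fix \<sigma>
      assume "\<sigma> \<in> cofaces_above S \<tau> - B"
      then have "\<omega> \<tau> * \<theta> \<tau> \<sigma> * \<eta> \<sigma> = 0"
        by (intro vanish[OF \<tau>]) (auto simp: cofaces_above_def)
      then show "m \<sigma> * (\<omega> \<tau> * \<theta> \<tau> \<sigma> * \<eta> \<sigma>) = 0" by (simp only: mult_zero_right)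
    qed simp
    finally show ?thesis .
  qed
  have "ip (\<delta> \<omega>) \<eta> = (\<Sum>\<sigma>\<in>B. m \<sigma> * \<delta> \<omega> \<sigma> * \<eta> \<sigma>)"
  proof (rule ip_finite_sum[OF B])
    fix \<sigma>
    assume \<sigma>: "\<sigma> \<in> S - B"
    then have "\<delta> \<omega> \<sigma> * \<eta> \<sigma> = (\<Sum>\<tau>\<in>A. \<omega> \<tau> * \<theta> \<tau> \<sigma> * \<eta> \<sigma>)"
      by (intro left) simp
    also have "\<dots> = 0"
      by (rule sum.neutral) (use vanish \<sigma> A(2) in blast)
    finally show "\<delta> \<omega> \<sigma> * \<eta> \<sigma> = 0" .
  qed
  also have "\<dots> = (\<Sum>\<sigma>\<in>B. \<Sum>\<tau>\<in>A. m \<sigma> * (\<omega> \<tau> * \<theta> \<tau> \<sigma> * \<eta> \<sigma>))"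
    using left B(2) by (intro sum.cong refl) (auto simp: mult.assoc sum_distrib_left)
  also have "\<dots> = (\<Sum>\<tau>\<in>A. \<Sum>\<sigma>\<in>B. m \<sigma> * (\<omega> \<tau> * \<theta> \<tau> \<sigma> * \<eta> \<sigma>))"
    by (rule sum.swap)
  also have "\<dots> = (\<Sum>\<tau>\<in>A. m \<tau> * \<omega> \<tau> * bd \<eta> \<tau>)"
  proof (rule sum.cong[OF refl])
    fix \<tau>
    assume "\<tau> \<in> A"
    then show "(\<Sum>\<sigma>\<in>B. m \<sigma> * (\<omega> \<tau> * \<theta> \<tau> \<sigma> * \<eta> \<sigma>)) = m \<tau> * \<omega> \<tau> * bd \<eta> \<tau>"
      using right[of \<tau>] A(2) by (auto simp: mult_ac)
  qed
  also have "\<dots> = ip \<omega> (bd \<eta>)"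
  proof (rule ip_finite_sum[OF A, symmetric])
    fix \<tau>
    assume \<tau>: "\<tau> \<in> S - A"
    then have "\<omega> \<tau> * (m \<tau> * bd \<eta> \<tau>) = (\<Sum>\<sigma>\<in>B. m \<sigma> * (\<omega> \<tau> * \<theta> \<tau> \<sigma> * \<eta> \<sigma>))"
      by (intro right) simp
    also have "\<dots> = 0"
    proof (rule sum.neutral, rule ballI)
      fix \<sigma>
      assume "\<sigma> \<in> B"
      then have "\<omega> \<tau> * \<theta> \<tau> \<sigma> * \<eta> \<sigma> = 0"
        using vanish \<tau> B(2) by blast
      then show "m \<sigma> * (\<omega> \<tau> * \<theta> \<tau> \<sigma> * \<eta> \<sigma>) = 0" by (simp only: mult_zero_right)
    qed
    finally have "\<omega> \<tau> * (m \<tau> * bd \<eta> \<tau>) = 0" .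
    then show "\<omega> \<tau> * bd \<eta> \<tau> = 0"
      using weight_pos[of \<tau>] \<tau> by simp
  qed
  finally show ?thesis .
qed

lemma Green_left:
  assumes "\<omega> \<in> Fin"
  shows "ip (\<delta> \<omega>) \<eta> = ip \<omega> (bd \<eta>)"
proof -
  note \<omega> = finite_cochain_cochain[OF assms]
  show ?thesis
  proof (rule Green_formula[OF \<omega>])
    show "finite {\<tau>. \<omega> \<tau> \<noteq> 0}" "{\<tau>. \<omega> \<tau> \<noteq> 0} \<subseteq> S"
      using assms support_subset[OF \<omega>] by (auto simp: finite_cochains_def)
    then show "finite (\<Union>\<tau>\<in>{\<tau>. \<omega> \<tau> \<noteq> 0}. cofaces_above S \<tau>)"
        "(\<Union>\<tau>\<in>{\<tau>. \<omega> \<tau> \<noteq> 0}. cofaces_above S \<tau>) \<subseteq> S"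
      using finite_cofaces by (auto simp: cofaces_above_def)
  qed (auto simp: cofaces_above_def)
qed

lemma Green_right:
  assumes \<omega>: "\<omega> \<in> C" and \<eta>: "\<eta> \<in> Fin"
  shows "ip (\<delta> \<omega>) \<eta> = ip \<omega> (bd \<eta>)"
proof (rule Green_formula[OF \<omega>, where B = "{\<sigma>. \<eta> \<sigma> \<noteq> 0}" and A = "\<Union>\<sigma>\<in>{\<sigma>. \<eta> \<sigma> \<noteq> 0}. faces_below S \<sigma>"])
  show "finite {\<sigma>. \<eta> \<sigma> \<noteq> 0}" "{\<sigma>. \<eta> \<sigma> \<noteq> 0} \<subseteq> S"
    using \<eta> support_subset[OF finite_cochain_cochain[OF \<eta>]] by (auto simp: finite_cochains_def)
  then show "finite (\<Union>\<sigma>\<in>{\<sigma>. \<eta> \<sigma> \<noteq> 0}. faces_below S \<sigma>)"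
      "(\<Union>\<sigma>\<in>{\<sigma>. \<eta> \<sigma> \<noteq> 0}. faces_below S \<sigma>) \<subseteq> S"
    using finite_faces by (auto simp: faces_below_def)
qed (auto simp: faces_below_def)

text \<open>Dual to \<delta>\<delta> = 0: both boundaries are moved onto an indicator, whose
  coboundary is still finitely supported.\<close>

lemma boundary_boundary: "bd (bd \<omega>) = (\<lambda>_. 0)"
proof
  fix \<rho>
  show "bd (bd \<omega>) \<rho> = 0"
  proof (cases "\<rho> \<in> S")
    case True
    note ind = indicator_finite_cochain[OF True]
    have "m \<rho> * bd (bd \<omega>) \<rho> = ip (\<delta> (\<delta> (indicator {\<rho>}))) \<omega>"
      by (simp add: ip_indicator[OF True, symmetric] Green_left ind coboundary_finite)
    also have "\<dots> = 0"
      by (simp add: coboundary_coboundary[OF indicator_cochain[OF True]] l2_inner_def)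
    finally show ?thesis
      using weight_pos[OF True] by simp
  qed (simp add: boundary_operator_def)
qed


section \<open>The maximum principle\<close>

lemma incidence_square:
  "\<tau> \<in> S \<Longrightarrow> \<sigma> \<in> S \<Longrightarrow> covered_by \<tau> \<sigma> \<Longrightarrow> \<theta> \<tau> \<sigma> * \<theta> \<tau> \<sigma> = 1"
  using incidence_cases[of \<tau> \<sigma>] by auto

text \<open>Evaluating \<delta>\<delta> = 0 on the indicator of \<rho> leaves two products with sum
  zero, one for each intermediate simplex; as all factors are 1 or -1, they can be regrouped. This
  sign rule is the source of the difference in the Forman curvature.\<close>

lemma incidence_diamond:
  assumes S: "\<rho> \<in> S" "\<tau> \<in> S" "\<tau>' \<in> S" "\<sigma> \<in> S"
    and cov: "covered_by \<rho> \<tau>" "covered_by \<rho> \<tau>'" "covered_by \<tau> \<sigma>" "covered_by \<tau>' \<sigma>"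
    and neq: "\<tau>' \<noteq> \<tau>"
  shows "\<theta> \<tau> \<sigma> * \<theta> \<tau>' \<sigma> = - (\<theta> \<rho> \<tau> * \<theta> \<rho> \<tau>')"
proof -
  note ind = indicator_cochain[OF S(1)]
  have "0 = \<delta> (\<delta> (indicator {\<rho>})) \<sigma>"
    by (simp add: coboundary_coboundary[OF ind])
  also have "\<dots> = (\<Sum>\<tau>''\<in>faces_below S \<sigma>. \<theta> \<rho> \<tau>'' * \<theta> \<tau>'' \<sigma>)"
    by (simp add: coboundary_eq[OF coboundary_cochain[OF ind] S(4)] incidence_def)
  also have "\<dots> = (\<Sum>\<tau>''\<in>{\<tau>, \<tau>'}. \<theta> \<rho> \<tau>'' * \<theta> \<tau>'' \<sigma>)"
  proof (rule sum.mono_neutral_right[OF finite_faces[OF S(4)]])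
    show "{\<tau>, \<tau>'} \<subseteq> faces_below S \<sigma>"
      using S cov by (auto simp: faces_below_def)
    show "\<forall>\<tau>''\<in>faces_below S \<sigma> - {\<tau>, \<tau>'}. \<theta> \<rho> \<tau>'' * \<theta> \<tau>'' \<sigma> = 0"
    proof
      fix \<tau>''
      assume *: "\<tau>'' \<in> faces_below S \<sigma> - {\<tau>, \<tau>'}"
      then have "\<not> covered_by \<rho> \<tau>''"
        using covered_by_diamond[OF cov neq, of \<tau>''] unfolding faces_below_def by blast
      with * show "\<theta> \<rho> \<tau>'' * \<theta> \<tau>'' \<sigma> = 0"
        using incidence_eq_0[OF S(1), of \<tau>''] by (simp add: faces_below_def)
    qed
  qed
  also have "\<dots> = \<theta> \<rho> \<tau> * \<theta> \<tau> \<sigma> + \<theta> \<rho> \<tau>' * \<theta> \<tau>' \<sigma>"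
    using neq by simp
  finally show ?thesis
    using incidence_cases[OF S(1,2) cov(1)] incidence_cases[OF S(1,3) cov(2)]
      incidence_cases[OF S(2,4) cov(3)] incidence_cases[OF S(3,4) cov(4)]
    by auto
qed

text \<open>Multiplication by \<open>m \<tau>\<close> makes the matrix of the operator symmetric.
  The row at \<tau> is split into its diagonal entry, where the sign squares to 1, and the
  neighbours of \<tau> through common cofaces.\<close>

lemma boundary_coboundary_expand:
  assumes \<eta>: "\<eta> \<in> C" and \<tau>: "\<tau> \<in> S"
  shows "m \<tau> * bd (\<delta> \<eta>) \<tau> = (\<Sum>\<sigma>\<in>cofaces_above S \<tau>. m \<sigma> *
    (\<eta> \<tau> + (\<Sum>\<tau>'\<in>faces_below S \<sigma> - {\<tau>}. \<theta> \<tau> \<sigma> * \<theta> \<tau>' \<sigma> * \<eta> \<tau>')))"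
  unfolding boundary_eq[OF \<tau>]
proof (rule sum.cong[OF refl])
  fix \<sigma>
  assume "\<sigma> \<in> cofaces_above S \<tau>"
  then have \<sigma>: "\<sigma> \<in> S" "covered_by \<tau> \<sigma>" and "\<tau> \<in> faces_below S \<sigma>"
    using \<tau> by (auto simp: cofaces_above_def faces_below_def)
  then have "\<delta> \<eta> \<sigma> = \<eta> \<tau> * \<theta> \<tau> \<sigma> + (\<Sum>\<tau>'\<in>faces_below S \<sigma> - {\<tau>}. \<eta> \<tau>' * \<theta> \<tau>' \<sigma>)"
    unfolding coboundary_eq[OF \<eta> \<sigma>(1)] by (intro sum.remove finite_faces)
  then have "\<delta> \<eta> \<sigma> * \<theta> \<tau> \<sigma> = \<eta> \<tau> * (\<theta> \<tau> \<sigma> * \<theta> \<tau> \<sigma>)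
      + (\<Sum>\<tau>'\<in>faces_below S \<sigma> - {\<tau>}. \<theta> \<tau> \<sigma> * \<theta> \<tau>' \<sigma> * \<eta> \<tau>')"
    by (simp add: algebra_simps sum_distrib_left sum_distrib_right)
  then show "m \<sigma> * \<delta> \<eta> \<sigma> * \<theta> \<tau> \<sigma> = m \<sigma> *
      (\<eta> \<tau> + (\<Sum>\<tau>'\<in>faces_below S \<sigma> - {\<tau>}. \<theta> \<tau> \<sigma> * \<theta> \<tau>' \<sigma> * \<eta> \<tau>'))"
    unfolding incidence_square[OF \<tau> \<sigma>] by (simp add: mult.assoc)
qed

lemma coboundary_boundary_expand:
  assumes \<tau>: "\<tau> \<in> S"
  shows "m \<tau> * \<delta> (bd \<eta>) \<tau> = (\<Sum>\<rho>\<in>faces_below S \<tau>. (m \<tau>)\<^sup>2 / m \<rho> * \<eta> \<tau>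
    + (\<Sum>\<tau>'\<in>cofaces_above S \<rho> - {\<tau>}. m \<tau> * m \<tau>' / m \<rho> * (\<theta> \<rho> \<tau> * \<theta> \<rho> \<tau>' * \<eta> \<tau>')))"
  unfolding coboundary_eq[OF boundary_cochain \<tau>] sum_distrib_left
proof (rule sum.cong[OF refl])
  fix \<rho>
  assume "\<rho> \<in> faces_below S \<tau>"
  then have \<rho>: "\<rho> \<in> S" "covered_by \<rho> \<tau>" and \<tau>': "\<tau> \<in> cofaces_above S \<rho>"
    using \<tau> by (auto simp: cofaces_above_def faces_below_def)
  have "m \<rho> * bd \<eta> \<rho> = m \<tau> * \<eta> \<tau> * \<theta> \<rho> \<tau> + (\<Sum>\<tau>'\<in>cofaces_above S \<rho> - {\<tau>}. m \<tau>' * \<eta> \<tau>' * \<theta> \<rho> \<tau>')"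
    unfolding boundary_eq[OF \<rho>(1)] by (rule sum.remove[OF finite_cofaces[OF \<rho>(1)] \<tau>'])
  then have "bd \<eta> \<rho> = (m \<tau> * \<eta> \<tau> * \<theta> \<rho> \<tau> + (\<Sum>\<tau>'\<in>cofaces_above S \<rho> - {\<tau>}. m \<tau>' * \<eta> \<tau>' * \<theta> \<rho> \<tau>')) / m \<rho>"
    using weight_pos[OF \<rho>(1)] by (simp add: field_simps)
  then have "m \<tau> * (bd \<eta> \<rho> * \<theta> \<rho> \<tau>) = (m \<tau>)\<^sup>2 / m \<rho> * \<eta> \<tau> * (\<theta> \<rho> \<tau> * \<theta> \<rho> \<tau>)
      + (\<Sum>\<tau>'\<in>cofaces_above S \<rho> - {\<tau>}. m \<tau> * m \<tau>' / m \<rho> * (\<theta> \<rho> \<tau> * \<theta> \<rho> \<tau>' * \<eta> \<tau>'))"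
    by (simp add: add_divide_distrib distrib_left distrib_right sum_distrib_left sum_distrib_right
        sum_divide_distrib power2_eq_square mult_ac)
  then show "m \<tau> * (bd \<eta> \<rho> * \<theta> \<rho> \<tau>) = (m \<tau>)\<^sup>2 / m \<rho> * \<eta> \<tau>
      + (\<Sum>\<tau>'\<in>cofaces_above S \<rho> - {\<tau>}. m \<tau> * m \<tau>' / m \<rho> * (\<theta> \<rho> \<tau> * \<theta> \<rho> \<tau>' * \<eta> \<tau>'))"
    unfolding incidence_square[OF \<rho>(1) \<tau> \<rho>(2)] by simp
qed

text \<open>Distinct \<open>\<tau>, \<tau>' \<prec> \<sigma>\<close> have the common face \<open>\<tau> \<inter> \<tau>'\<close>.\<close>

lemma sum_neighbours_reindex:
  fixes g :: "'v set \<Rightarrow> 'v set \<Rightarrow> real"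
  assumes \<tau>: "\<tau> \<in> S" and faces: "\<And>\<rho>. covered_by \<rho> \<tau> \<Longrightarrow> \<rho> \<in> S"
  shows "(\<Sum>\<sigma>\<in>cofaces_above S \<tau>. \<Sum>\<tau>'\<in>faces_below S \<sigma> - {\<tau>}. g \<tau>' \<sigma>)
    = (\<Sum>\<rho>\<in>faces_below S \<tau>. \<Sum>\<tau>'\<in>cofaces_above S \<rho> - {\<tau>}.
        \<Sum>\<sigma>\<in>{\<sigma>\<in>S. covered_by \<tau> \<sigma> \<and> covered_by \<tau>' \<sigma>}. g \<tau>' \<sigma>)"
proof -
  let ?U = "\<lambda>\<tau>'. {\<sigma>\<in>S. covered_by \<tau> \<sigma> \<and> covered_by \<tau>' \<sigma>}"
  have finU: "finite (?U \<tau>')" for \<tau>'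
    by (rule finite_subset[OF _ finite_cofaces[OF \<tau>]]) (auto simp: cofaces_above_def)
  have cofaces: "\<sigma> \<in> S" if "\<sigma> \<in> cofaces_above S \<tau>" for \<sigma>
    using that by (simp add: cofaces_above_def)
  have faces': "\<rho> \<in> S" if "\<rho> \<in> faces_below S \<tau>" for \<rho>
    using that by (simp add: faces_below_def)
  have "(\<Sum>\<sigma>\<in>cofaces_above S \<tau>. \<Sum>\<tau>'\<in>faces_below S \<sigma> - {\<tau>}. g \<tau>' \<sigma>)
      = (\<Sum>(\<sigma>, \<tau>')\<in>(SIGMA \<sigma>:cofaces_above S \<tau>. faces_below S \<sigma> - {\<tau>}). g \<tau>' \<sigma>)"
    using finite_cofaces[OF \<tau>] finite_faces cofaces by (intro sum.Sigma) auto
  also have "\<dots> = (\<Sum>(\<rho>, \<tau>', \<sigma>)\<in>(SIGMA \<rho>:faces_below S \<tau>. SIGMA \<tau>':cofaces_above S \<rho> - {\<tau>}. ?U \<tau>'). g \<tau>' \<sigma>)"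
  proof (rule sum.reindex_bij_witness[where i = "\<lambda>(\<rho>, \<tau>', \<sigma>). (\<sigma>, \<tau>')" and j = "\<lambda>(\<sigma>, \<tau>'). (\<tau> \<inter> \<tau>', \<tau>', \<sigma>)"])
    fix a
    assume "a \<in> (SIGMA \<sigma>:cofaces_above S \<tau>. faces_below S \<sigma> - {\<tau>})"
    then obtain \<sigma> \<tau>' where a: "a = (\<sigma>, \<tau>')" "\<sigma> \<in> S" "covered_by \<tau> \<sigma>" "\<tau>' \<in> S" "covered_by \<tau>' \<sigma>" "\<tau>' \<noteq> \<tau>"
      by (auto simp: cofaces_above_def faces_below_def)
    note cov = covered_by_inter[OF a(3,5,6)]
    show "(case case a of (\<sigma>, \<tau>') \<Rightarrow> (\<tau> \<inter> \<tau>', \<tau>', \<sigma>) of (\<rho>, \<tau>', \<sigma>) \<Rightarrow> (\<sigma>, \<tau>')) = a"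
      by (simp add: a(1))
    \<comment> \<open>Here \<open>faces\<close> is used: the common face has to lie in
      \<open>S\<close>, which for a vertex \<tau> means that the empty simplex is present.\<close>
    show "(case a of (\<sigma>, \<tau>') \<Rightarrow> (\<tau> \<inter> \<tau>', \<tau>', \<sigma>))
        \<in> (SIGMA \<rho>:faces_below S \<tau>. SIGMA \<tau>':cofaces_above S \<rho> - {\<tau>}. ?U \<tau>')"
      using a cov faces[OF cov(1)] by (simp add: cofaces_above_def faces_below_def)
    show "(case case a of (\<sigma>, \<tau>') \<Rightarrow> (\<tau> \<inter> \<tau>', \<tau>', \<sigma>) of (\<rho>, \<tau>', \<sigma>) \<Rightarrow> g \<tau>' \<sigma>) = (case a of (\<sigma>, \<tau>') \<Rightarrow> g \<tau>' \<sigma>)"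
      by (simp add: a(1))
  next
    fix b
    assume "b \<in> (SIGMA \<rho>:faces_below S \<tau>. SIGMA \<tau>':cofaces_above S \<rho> - {\<tau>}. ?U \<tau>')"
    then obtain \<rho> \<tau>' \<sigma> where b: "b = (\<rho>, \<tau>', \<sigma>)" "\<sigma> \<in> S" "covered_by \<tau> \<sigma>" "\<tau>' \<in> S" "covered_by \<tau>' \<sigma>" "\<tau>' \<noteq> \<tau>"
      "covered_by \<rho> \<tau>" "covered_by \<rho> \<tau>'"
      by (auto simp: cofaces_above_def faces_below_def)
    show "(case case b of (\<rho>, \<tau>', \<sigma>) \<Rightarrow> (\<sigma>, \<tau>') of (\<sigma>, \<tau>') \<Rightarrow> (\<tau> \<inter> \<tau>', \<tau>', \<sigma>)) = b"
      using covered_by_unique_inter[OF b(7,8,6)] by (simp add: b(1))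
    show "(case b of (\<rho>, \<tau>', \<sigma>) \<Rightarrow> (\<sigma>, \<tau>')) \<in> (SIGMA \<sigma>:cofaces_above S \<tau>. faces_below S \<sigma> - {\<tau>})"
      using b by (simp add: cofaces_above_def faces_below_def)
  qed
  also have "\<dots> = (\<Sum>\<rho>\<in>faces_below S \<tau>. \<Sum>(\<tau>', \<sigma>)\<in>(SIGMA \<tau>':cofaces_above S \<rho> - {\<tau>}. ?U \<tau>'). g \<tau>' \<sigma>)"
    using finite_faces[OF \<tau>] finite_cofaces faces' finU by (intro sum.Sigma[symmetric]) auto
  also have "\<dots> = (\<Sum>\<rho>\<in>faces_below S \<tau>. \<Sum>\<tau>'\<in>cofaces_above S \<rho> - {\<tau>}. \<Sum>\<sigma>\<in>?U \<tau>'. g \<tau>' \<sigma>)"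
    using finite_cofaces faces' finU by (intro sum.cong[OF refl] sum.Sigma[symmetric]) auto
  finally show ?thesis .
qed

lemma forman_c_eq:
  assumes \<tau>: "\<tau> \<in> S"
  shows "forman_c S m \<tau> = (\<Sum>\<rho>\<in>faces_below S \<tau>. (m \<tau>)\<^sup>2 / m \<rho>) + (\<Sum>\<sigma>\<in>cofaces_above S \<tau>. m \<sigma>)
    - (\<Sum>\<rho>\<in>faces_below S \<tau>. \<Sum>\<tau>'\<in>cofaces_above S \<rho> - {\<tau>}.
        \<bar>m \<tau> * m \<tau>' / m \<rho> - (\<Sum>\<sigma>\<in>{\<sigma>\<in>S. covered_by \<tau> \<sigma> \<and> covered_by \<tau>' \<sigma>}. m \<sigma>)\<bar>)"
proof -
  have "finite {\<sigma>\<in>S. covered_by \<tau> \<sigma> \<and> covered_by \<tau>' \<sigma>}" for \<tau>'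
    by (rule finite_subset[OF _ finite_cofaces[OF \<tau>]]) (auto simp: cofaces_above_def)
  then have U: "(\<Sum>\<^sub>\<infinity>\<sigma>\<in>{\<sigma>\<in>S. covered_by \<tau> \<sigma> \<and> covered_by \<tau>' \<sigma>}. m \<sigma>)
      = (\<Sum>\<sigma>\<in>{\<sigma>\<in>S. covered_by \<tau> \<sigma> \<and> covered_by \<tau>' \<sigma>}. m \<sigma>)" for \<tau>'
    by (rule infsum_finite)
  have "infsum f (cofaces_above S \<rho> - {\<tau>}) = sum f (cofaces_above S \<rho> - {\<tau>})"
    if "\<rho> \<in> faces_below S \<tau>" for \<rho> and f :: "'v set \<Rightarrow> real"
    using that finite_cofaces[of \<rho>] by (simp add: faces_below_def)
  then show ?thesis
    using finite_cofaces[OF \<tau>] by (simp add: forman_c_def U cong: sum.cong)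
qed

text \<open>A Gershgorin estimate at a maximum point of the absolute value of \<eta>. Each
  off-diagonal entry is \<open>?K \<rho> \<tau>'\<close> up to sign, and replacing the value at
  \<tau>' by the maximal one costs at most its absolute value; what remains is the diagonal minus
  the absolute row sum.\<close>

lemma Hodge_lower_bound_faces:
  assumes \<eta>: "\<eta> \<in> C" and \<tau>: "\<tau> \<in> S" and faces: "\<And>\<rho>. covered_by \<rho> \<tau> \<Longrightarrow> \<rho> \<in> S"
    and max: "\<And>\<tau>'. \<tau>' \<in> S \<Longrightarrow> \<bar>\<eta> \<tau>'\<bar> \<le> \<bar>\<eta> \<tau>\<bar>"
  shows "forman_c S m \<tau> * (\<eta> \<tau>)\<^sup>2 \<le> m \<tau> * (bd (\<delta> \<eta>) \<tau> + \<delta> (bd \<eta>) \<tau>) * \<eta> \<tau>"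
proof -
  let ?F = "faces_below S \<tau>" and ?G = "cofaces_above S \<tau>" and ?N = "\<lambda>\<rho>. cofaces_above S \<rho> - {\<tau>}"
  let ?s = "\<lambda>\<rho> \<tau>'. \<theta> \<rho> \<tau> * \<theta> \<rho> \<tau>' * \<eta> \<tau>'"
  let ?M = "\<lambda>\<tau>'. \<Sum>\<sigma>\<in>{\<sigma>\<in>S. covered_by \<tau> \<sigma> \<and> covered_by \<tau>' \<sigma>}. m \<sigma>"
  let ?K = "\<lambda>\<rho> \<tau>'. m \<tau> * m \<tau>' / m \<rho> - ?M \<tau>'"
  define D where "D = (\<Sum>\<rho>\<in>?F. (m \<tau>)\<^sup>2 / m \<rho>) + (\<Sum>\<sigma>\<in>?G. m \<sigma>)"
  have "m \<tau> * bd (\<delta> \<eta>) \<tau> = (\<Sum>\<sigma>\<in>?G. m \<sigma> * \<eta> \<tau>)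
      + (\<Sum>\<sigma>\<in>?G. \<Sum>\<tau>'\<in>faces_below S \<sigma> - {\<tau>}. m \<sigma> * (\<theta> \<tau> \<sigma> * \<theta> \<tau>' \<sigma> * \<eta> \<tau>'))"
    unfolding boundary_coboundary_expand[OF \<eta> \<tau>]
    by (simp add: distrib_left sum.distrib sum_distrib_left)
  also have "(\<Sum>\<sigma>\<in>?G. \<Sum>\<tau>'\<in>faces_below S \<sigma> - {\<tau>}. m \<sigma> * (\<theta> \<tau> \<sigma> * \<theta> \<tau>' \<sigma> * \<eta> \<tau>'))
      = (\<Sum>\<rho>\<in>?F. \<Sum>\<tau>'\<in>?N \<rho>. \<Sum>\<sigma>\<in>{\<sigma>\<in>S. covered_by \<tau> \<sigma> \<and> covered_by \<tau>' \<sigma>}. m \<sigma> * (\<theta> \<tau> \<sigma> * \<theta> \<tau>' \<sigma> * \<eta> \<tau>'))"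
    by (rule sum_neighbours_reindex[OF \<tau> faces])
  \<comment> \<open>The sign rule expresses the part coming from \<partial>\<delta> through the
    signs of \<delta>\<partial>, with a minus, so that both merge into \<open>?K\<close>.\<close>
  also have "\<dots> = (\<Sum>\<rho>\<in>?F. \<Sum>\<tau>'\<in>?N \<rho>. - (?M \<tau>' * ?s \<rho> \<tau>'))"
  proof (intro sum.cong[OF refl])
    fix \<rho> \<tau>'
    assume "\<rho> \<in> ?F" "\<tau>' \<in> ?N \<rho>"
    then have *: "\<rho> \<in> S" "covered_by \<rho> \<tau>" "\<tau>' \<in> S" "covered_by \<rho> \<tau>'" "\<tau>' \<noteq> \<tau>"
      by (auto simp: faces_below_def cofaces_above_def)
    have "m \<sigma> * (\<theta> \<tau> \<sigma> * \<theta> \<tau>' \<sigma> * \<eta> \<tau>') = - (m \<sigma> * ?s \<rho> \<tau>')"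
      if "\<sigma> \<in> {\<sigma>\<in>S. covered_by \<tau> \<sigma> \<and> covered_by \<tau>' \<sigma>}" for \<sigma>
    proof -
      have "\<theta> \<tau> \<sigma> * \<theta> \<tau>' \<sigma> = - (\<theta> \<rho> \<tau> * \<theta> \<rho> \<tau>')"
        using that by (intro incidence_diamond * \<tau>) auto
      then show ?thesis by simp
    qed
    then show "(\<Sum>\<sigma>\<in>{\<sigma>\<in>S. covered_by \<tau> \<sigma> \<and> covered_by \<tau>' \<sigma>}. m \<sigma> * (\<theta> \<tau> \<sigma> * \<theta> \<tau>' \<sigma> * \<eta> \<tau>'))
        = - (?M \<tau>' * ?s \<rho> \<tau>')"
      by (simp add: sum_distrib_right sum_negf)
  qed
  finally have "m \<tau> * (bd (\<delta> \<eta>) \<tau> + \<delta> (bd \<eta>) \<tau>) = D * \<eta> \<tau> + (\<Sum>\<rho>\<in>?F. \<Sum>\<tau>'\<in>?N \<rho>. ?K \<rho> \<tau>' * ?s \<rho> \<tau>')"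
    unfolding distrib_left[of "m \<tau>"] coboundary_boundary_expand[OF \<tau>] D_def
    by (simp add: sum.distrib sum_negf sum_subtractf left_diff_distrib distrib_right sum_distrib_right)
  then have eq: "m \<tau> * (bd (\<delta> \<eta>) \<tau> + \<delta> (bd \<eta>) \<tau>) * \<eta> \<tau>
      = D * (\<eta> \<tau>)\<^sup>2 + (\<Sum>\<rho>\<in>?F. \<Sum>\<tau>'\<in>?N \<rho>. ?K \<rho> \<tau>' * ?s \<rho> \<tau>' * \<eta> \<tau>)"
    by (simp add: distrib_right sum_distrib_right power2_eq_square mult.assoc)
  have "- (\<bar>?K \<rho> \<tau>'\<bar> * (\<eta> \<tau>)\<^sup>2) \<le> ?K \<rho> \<tau>' * ?s \<rho> \<tau>' * \<eta> \<tau>" if "\<rho> \<in> ?F" "\<tau>' \<in> ?N \<rho>" for \<rho> \<tau>'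
  proof -
    have *: "\<rho> \<in> S" "covered_by \<rho> \<tau>" "\<tau>' \<in> S" "covered_by \<rho> \<tau>'"
      using that by (auto simp: faces_below_def cofaces_above_def)
    have "\<bar>\<theta> \<rho> \<tau>\<bar> = 1" "\<bar>\<theta> \<rho> \<tau>'\<bar> = 1"
      using incidence_cases[OF *(1) \<tau> *(2)] incidence_cases[OF *(1,3,4)] by auto
    then have "\<bar>?K \<rho> \<tau>' * ?s \<rho> \<tau>' * \<eta> \<tau>\<bar> = \<bar>?K \<rho> \<tau>'\<bar> * (\<bar>\<eta> \<tau>'\<bar> * \<bar>\<eta> \<tau>\<bar>)"
      by (simp add: abs_mult)
    also have "\<dots> \<le> \<bar>?K \<rho> \<tau>'\<bar> * (\<bar>\<eta> \<tau>\<bar> * \<bar>\<eta> \<tau>\<bar>)"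
      by (intro mult_left_mono mult_right_mono max *(3)) auto
    also have "\<dots> = \<bar>?K \<rho> \<tau>'\<bar> * (\<eta> \<tau>)\<^sup>2"
      by (simp add: power2_eq_square)
    finally show ?thesis by linarith
  qed
  then have "(\<Sum>\<rho>\<in>?F. \<Sum>\<tau>'\<in>?N \<rho>. - (\<bar>?K \<rho> \<tau>'\<bar> * (\<eta> \<tau>)\<^sup>2)) \<le> (\<Sum>\<rho>\<in>?F. \<Sum>\<tau>'\<in>?N \<rho>. ?K \<rho> \<tau>' * ?s \<rho> \<tau>' * \<eta> \<tau>)"
    by (intro sum_mono)
  moreover have "forman_c S m \<tau> * (\<eta> \<tau>)\<^sup>2
      = D * (\<eta> \<tau>)\<^sup>2 + (\<Sum>\<rho>\<in>?F. \<Sum>\<tau>'\<in>?N \<rho>. - (\<bar>?K \<rho> \<tau>'\<bar> * (\<eta> \<tau>)\<^sup>2))"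
    unfolding forman_c_eq[OF \<tau>] D_def
    by (simp add: left_diff_distrib sum_negf sum_distrib_right)
  ultimately show ?thesis
    unfolding eq by linarith
qed

text \<open>
  For a vertex whose empty face is not in \<open>S\<close> the value \<open>forman_c\<close> overestimates the potential,
  which is then zero.
\<close>

lemma Hodge_lower_bound_vertex:
  assumes \<eta>: "\<eta> \<in> C" and \<tau>: "{v} \<in> S" and empty: "{} \<notin> S"
    and max: "\<And>\<tau>'. \<tau>' \<in> S \<Longrightarrow> \<bar>\<eta> \<tau>'\<bar> \<le> \<bar>\<eta> {v}\<bar>"
  shows "0 \<le> m {v} * (bd (\<delta> \<eta>) {v} + \<delta> (bd \<eta>) {v}) * \<eta> {v}"
proof -
  have "faces_below S {v} = {}"
    using empty by (auto simp: faces_below_def covered_by_def subset_singleton_iff)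
  then have zero: "m {v} * \<delta> (bd \<eta>) {v} = 0"
    by (simp add: coboundary_boundary_expand[OF \<tau>])
  \<comment> \<open>Each edge is estimated alone: up to sign its other endpoint enters with a value
    of modulus at most that at \<open>v\<close>, so it cannot outweigh the diagonal term.\<close>
  have "0 \<le> m \<sigma> * (\<eta> {v} + (\<Sum>\<tau>'\<in>faces_below S \<sigma> - {{v}}. \<theta> {v} \<sigma> * \<theta> \<tau>' \<sigma> * \<eta> \<tau>')) * \<eta> {v}"
    if "\<sigma> \<in> cofaces_above S {v}" for \<sigma>
  proof -
    have \<sigma>: "\<sigma> \<in> S" "covered_by {v} \<sigma>"
      using that by (auto simp: cofaces_above_def)
    then obtain u where u: "u \<noteq> v" "\<sigma> = {u, v}"
      by (auto simp: covered_by_iff)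
    have "{u} \<in> S"
      using face_closed[OF \<sigma>(1), of "{u}"] u by simp
    have cov: "covered_by {u} \<sigma>"
      using u by (auto simp: covered_by_iff)
    have "faces_below S \<sigma> - {{v}} = {{u}}"
    proof -
      have "\<tau>' = {u} \<or> \<tau>' = {v}" if "covered_by \<tau>' \<sigma>" for \<tau>'
      proof -
        from that obtain w where w: "w \<notin> \<tau>'" "\<sigma> = insert w \<tau>'"
          by (auto simp: covered_by_iff)
        then have "\<tau>' = \<sigma> - {w}" "w \<in> \<sigma>" by auto
        then show ?thesis using u by auto
      qed
      then show ?thesis
        using \<open>{u} \<in> S\<close> cov u by (auto simp: faces_below_def)
    qed
    then have "(\<Sum>\<tau>'\<in>faces_below S \<sigma> - {{v}}. \<theta> {v} \<sigma> * \<theta> \<tau>' \<sigma> * \<eta> \<tau>') = \<theta> {v} \<sigma> * \<theta> {u} \<sigma> * \<eta> {u}"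
      by simp
    moreover have "\<bar>\<theta> {v} \<sigma>\<bar> = 1" "\<bar>\<theta> {u} \<sigma>\<bar> = 1"
      using incidence_cases[OF \<tau> \<sigma>] incidence_cases[OF \<open>{u} \<in> S\<close> \<sigma>(1) cov] by auto
    ultimately have "\<bar>\<Sum>\<tau>'\<in>faces_below S \<sigma> - {{v}}. \<theta> {v} \<sigma> * \<theta> \<tau>' \<sigma> * \<eta> \<tau>'\<bar> \<le> \<bar>\<eta> {v}\<bar>"
      using max[OF \<open>{u} \<in> S\<close>] by (simp add: abs_mult)
    then have "0 \<le> (\<eta> {v} + (\<Sum>\<tau>'\<in>faces_below S \<sigma> - {{v}}. \<theta> {v} \<sigma> * \<theta> \<tau>' \<sigma> * \<eta> \<tau>')) * \<eta> {v}"
      by (cases "\<eta> {v} \<ge> 0") (simp_all add: mult_nonneg_nonneg mult_nonpos_nonpos)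
    then show ?thesis
      using weight_pos[OF \<sigma>(1)] by (simp add: mult.assoc)
  qed
  then have "0 \<le> m {v} * bd (\<delta> \<eta>) {v} * \<eta> {v}"
    unfolding boundary_coboundary_expand[OF \<eta> \<tau>] sum_distrib_right by (rule sum_nonneg)
  then show ?thesis
    unfolding distrib_left[of "m {v}"] zero by simp
qed

text \<open>The superlevel set at a nonzero value of \<eta> carries a summable positive constant,
  hence is finite. Outside it all values are smaller, so its maximum is global.\<close>

lemma l2_attains_max:
  assumes \<eta>: "\<eta> \<in> \<H>" "\<eta> \<noteq> (\<lambda>_. 0)" and c: "c > 0" "\<And>\<tau>. \<tau> \<in> S \<Longrightarrow> c \<le> m \<tau>"
  obtains \<tau> where "\<tau> \<in> S" "\<eta> \<tau> \<noteq> 0" "\<And>\<tau>'. \<tau>' \<in> S \<Longrightarrow> \<bar>\<eta> \<tau>'\<bar> \<le> \<bar>\<eta> \<tau>\<bar>"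
proof -
  obtain \<tau>\<^sub>0 where nz: "\<eta> \<tau>\<^sub>0 \<noteq> 0"
    using \<eta>(2) by auto
  then have \<tau>\<^sub>0: "\<tau>\<^sub>0 \<in> S"
    using \<eta>(1) by (auto simp: l2_cochains_def cochains_def)
  define A where "A = {\<tau>\<in>S. \<bar>\<eta> \<tau>\<^sub>0\<bar> \<le> \<bar>\<eta> \<tau>\<bar>}"
  have "(\<lambda>\<sigma>. m \<sigma> * (\<eta> \<sigma>)\<^sup>2) summable_on A"
    using \<eta>(1) summable_on_subset_banach[of _ S A] by (auto simp: l2_cochains_def A_def)
  then have "(\<lambda>_. c * (\<eta> \<tau>\<^sub>0)\<^sup>2) summable_on A"
  proof (rule summable_on_comparison_test)
    fix \<sigma>
    assume "\<sigma> \<in> A"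
    then have "c \<le> m \<sigma>" "(\<eta> \<tau>\<^sub>0)\<^sup>2 \<le> (\<eta> \<sigma>)\<^sup>2"
      using c(2) by (auto simp: A_def abs_le_square_iff)
    then show "c * (\<eta> \<tau>\<^sub>0)\<^sup>2 \<le> m \<sigma> * (\<eta> \<sigma>)\<^sup>2"
      using c(1) by (intro mult_mono) auto
  qed (use c(1) in auto)
  moreover have "c * (\<eta> \<tau>\<^sub>0)\<^sup>2 \<noteq> 0"
    using c(1) nz by simp
  ultimately have fin: "finite A"
    using infsum_diverge_constant[of A "c * (\<eta> \<tau>\<^sub>0)\<^sup>2"] by auto
  have "\<tau>\<^sub>0 \<in> A" using \<tau>\<^sub>0 by (simp add: A_def)
  define M where "M = Max ((\<lambda>\<tau>. \<bar>\<eta> \<tau>\<bar>) ` A)"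
  have "M \<in> (\<lambda>\<tau>. \<bar>\<eta> \<tau>\<bar>) ` A"
    unfolding M_def using fin \<open>\<tau>\<^sub>0 \<in> A\<close> by (intro Max_in) auto
  then obtain \<tau> where \<tau>: "\<tau> \<in> A" "M = \<bar>\<eta> \<tau>\<bar>" by blast
  have le: "\<bar>\<eta> \<tau>'\<bar> \<le> \<bar>\<eta> \<tau>\<bar>" if "\<tau>' \<in> A" for \<tau>'
    using fin that unfolding \<tau>(2)[symmetric] M_def by simp
  show ?thesis
  proof
    show "\<tau> \<in> S" using \<tau> by (simp add: A_def)
    show "\<eta> \<tau> \<noteq> 0" using le[OF \<open>\<tau>\<^sub>0 \<in> A\<close>] nz by auto
    show "\<bar>\<eta> \<tau>'\<bar> \<le> \<bar>\<eta> \<tau>\<bar>" if "\<tau>' \<in> S" for \<tau>'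
      using le[of \<tau>'] le[OF \<open>\<tau>\<^sub>0 \<in> A\<close>] that by (cases "\<tau>' \<in> A") (auto simp: A_def)
  qed
qed

text \<open>At a maximum point the equation turns the quadratic expression into
  \<open>- l * m \<tau> * (\<eta> \<tau>)\<^sup>2\<close>. This contradicts the strict curvature
  bound if all faces of \<tau> lie in \<open>S\<close>, and otherwise nonnegativity together with
  \<open>l > 0\<close>.\<close>

lemma Hodge_eigenfunction_zero:
  assumes \<eta>: "\<eta> \<in> \<H>" and c: "c > 0" "\<And>\<tau>. \<tau> \<in> S \<Longrightarrow> c \<le> m \<tau>"
    and l: "l > 0" "\<And>\<tau>. \<tau> \<in> S \<Longrightarrow> - l * m \<tau> < forman_c S m \<tau>"
    and eq: "\<And>\<tau>. \<tau> \<in> S \<Longrightarrow> bd (\<delta> \<eta>) \<tau> + \<delta> (bd \<eta>) \<tau> = - l * \<eta> \<tau>"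
  shows "\<eta> = (\<lambda>_. 0)"
proof (rule ccontr)
  assume "\<eta> \<noteq> (\<lambda>_. 0)"
  from l2_attains_max[OF \<eta> this c] obtain \<tau>
    where \<tau>: "\<tau> \<in> S" "\<eta> \<tau> \<noteq> 0" and max: "\<And>\<tau>'. \<tau>' \<in> S \<Longrightarrow> \<bar>\<eta> \<tau>'\<bar> \<le> \<bar>\<eta> \<tau>\<bar>"
    by blast
  have \<eta>C: "\<eta> \<in> C" using \<eta> by (simp add: l2_cochains_def)
  have sq: "0 < (\<eta> \<tau>)\<^sup>2" using \<tau>(2) by simp
  have val: "m \<tau> * (bd (\<delta> \<eta>) \<tau> + \<delta> (bd \<eta>) \<tau>) * \<eta> \<tau> = - l * m \<tau> * (\<eta> \<tau>)\<^sup>2"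
    unfolding eq[OF \<tau>(1)] by (simp add: power2_eq_square)
  show False
  proof (cases "\<forall>\<rho>. covered_by \<rho> \<tau> \<longrightarrow> \<rho> \<in> S")
    case True
    then have "forman_c S m \<tau> * (\<eta> \<tau>)\<^sup>2 \<le> - l * m \<tau> * (\<eta> \<tau>)\<^sup>2"
      using Hodge_lower_bound_faces[OF \<eta>C \<tau>(1) _ max] val by auto
    moreover have "- l * m \<tau> * (\<eta> \<tau>)\<^sup>2 < forman_c S m \<tau> * (\<eta> \<tau>)\<^sup>2"
      using l(2)[OF \<tau>(1)] sq by (rule mult_strict_right_mono)
    ultimately show False by linarith
  next
    case False
    then obtain \<rho> where \<rho>: "covered_by \<rho> \<tau>" "\<rho> \<notin> S" by blast
    \<comment> \<open>Nonempty faces always lie in \<open>S\<close>, so a missing face is the empty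
      one and \<tau> is a vertex.\<close>
    then have "\<rho> = {}"
      using face_closed[OF \<tau>(1), of \<rho>] by (auto simp: covered_by_def)
    with \<rho> obtain v where v: "\<tau> = {v}" "{} \<notin> S"
      by (auto simp: covered_by_iff)
    then have "0 \<le> - l * m \<tau> * (\<eta> \<tau>)\<^sup>2"
      using Hodge_lower_bound_vertex[OF \<eta>C, of v] \<tau>(1) max val by simp
    moreover have "0 < l * m \<tau> * (\<eta> \<tau>)\<^sup>2"
      using l(1) weight_pos[OF \<tau>(1)] sq by simp
    ultimately show False by linarith
  qed
qed


section \<open>Essential self-adjointness of the Laplacians\<close>

lemma laplacian_plus_linear:
  assumes "\<omega> \<in> C" "\<eta> \<in> C"
  shows "bd (\<delta> (\<lambda>\<sigma>. a * \<omega> \<sigma> + b * \<eta> \<sigma>)) = (\<lambda>\<sigma>. a * bd (\<delta> \<omega>) \<sigma> + b * bd (\<delta> \<eta>) \<sigma>)"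
  by (simp add: coboundary_linear[OF assms] boundary_linear)

lemma laplacian_minus_linear:
  "\<delta> (bd (\<lambda>\<sigma>. a * \<omega> \<sigma> + b * \<eta> \<sigma>)) = (\<lambda>\<sigma>. a * \<delta> (bd \<omega>) \<sigma> + b * \<delta> (bd \<eta>) \<sigma>)"
  by (simp add: coboundary_linear[OF boundary_cochain boundary_cochain] boundary_linear)

text \<open>One argument is an arbitrary cochain, so the operator can be moved onto a deficiency
  function.\<close>

lemma laplacian_plus_symmetric:
  assumes "\<omega> \<in> Fin" "\<eta> \<in> C"
  shows "ip (bd (\<delta> \<omega>)) \<eta> = ip \<omega> (bd (\<delta> \<eta>))"
  using Green_right[OF assms(2) coboundary_finite[OF assms(1)]] Green_left[OF assms(1), of "\<delta> \<eta>"]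
  by (simp add: ip_commute[of "bd (\<delta> \<omega>)"] ip_commute[of "\<delta> \<eta>"])

lemma laplacian_minus_symmetric:
  assumes "\<omega> \<in> Fin"
  shows "ip (\<delta> (bd \<omega>)) \<eta> = ip \<omega> (\<delta> (bd \<eta>))"
  using Green_right[OF boundary_cochain assms, of \<eta>] Green_left[OF boundary_finite[OF assms], of \<eta>]
  by (simp add: ip_commute[of "bd \<omega>"] ip_commute[of \<omega>])

lemma laplacian_plus_nonneg: "\<omega> \<in> Fin \<Longrightarrow> 0 \<le> ip (bd (\<delta> \<omega>)) \<omega>"
  using Green_left[of \<omega> "\<delta> \<omega>"] ip_nonneg[of "\<delta> \<omega>"] by (simp add: ip_commute[of _ \<omega>])

lemma laplacian_minus_nonneg: "\<omega> \<in> Fin \<Longrightarrow> 0 \<le> ip (\<delta> (bd \<omega>)) \<omega>"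
  using Green_left[OF boundary_finite] ip_nonneg[of "bd \<omega>"] by simp

text \<open>Testing with indicators gives a pointwise equation. \<zeta> stands for the formal image
  of \<eta>; no square summability of it enters.\<close>

lemma weak_eigenfunction:
  assumes "\<And>\<omega>. \<omega> \<in> Fin \<Longrightarrow> ip (T \<omega>) \<eta> = - l * ip \<omega> \<eta>"
    and "\<And>\<omega>. \<omega> \<in> Fin \<Longrightarrow> ip (T \<omega>) \<eta> = ip \<omega> \<zeta>" and "\<tau> \<in> S"
  shows "\<zeta> \<tau> = - l * \<eta> \<tau>"
proof -
  have "m \<tau> * \<zeta> \<tau> = m \<tau> * (- l * \<eta> \<tau>)"
    using assms(1,2)[OF indicator_finite_cochain[OF \<open>\<tau> \<in> S\<close>]] by (simp add: ip_indicator[OF \<open>\<tau> \<in> S\<close>])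
  then show ?thesis
    using weight_pos[OF \<open>\<tau> \<in> S\<close>] unfolding mult_cancel_left by simp
qed

context
  fixes c l :: real
  assumes c: "c > 0" "\<And>\<tau>. \<tau> \<in> S \<Longrightarrow> c \<le> m \<tau>"
    and l: "l > 0" "\<And>\<tau>. \<tau> \<in> S \<Longrightarrow> - l * m \<tau> < forman_c S m \<tau>"
begin

lemma plus_operator: "nonneg_symmetric_operator S m (\<lambda>\<omega>. bd (\<delta> \<omega>)) l"
proof
  fix \<eta>
  assume \<eta>: "\<eta> \<in> \<H>" and weak: "\<And>\<omega>. \<omega> \<in> Fin \<Longrightarrow> ip (bd (\<delta> \<omega>)) \<eta> = - l * ip \<omega> \<eta>"
  then have \<eta>C: "\<eta> \<in> C" by (simp add: l2_cochains_def)
  have eq: "bd (\<delta> \<eta>) \<tau> = - l * \<eta> \<tau>" if "\<tau> \<in> S" for \<tau>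
    using weak laplacian_plus_symmetric[OF _ \<eta>C] that by (rule weak_eigenfunction)
  \<comment> \<open>The term with coefficient \<open>0\<close> brings the equation into the form of
    \<open>boundary_linear\<close>; applying \<partial> then gives l \<partial>\<eta> = 0.\<close>
  have "bd (\<delta> \<eta>) = (\<lambda>\<tau>. - l * \<eta> \<tau> + 0 * \<eta> \<tau>)"
  proof
    show "bd (\<delta> \<eta>) \<tau> = - l * \<eta> \<tau> + 0 * \<eta> \<tau>" for \<tau>
      using eq \<eta>C boundary_cochain[of "\<delta> \<eta>"]
      by (cases "\<tau> \<in> S") (auto simp: cochains_def)
  qed
  then have "(\<lambda>\<sigma>. - l * bd \<eta> \<sigma> + 0 * bd \<eta> \<sigma>) = bd (bd (\<delta> \<eta>))"
    by (simp only: boundary_linear)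
  then have "bd \<eta> = (\<lambda>_. 0)"
    using l(1) by (simp add: boundary_boundary fun_eq_iff)
  then show "\<eta> = (\<lambda>_. 0)"
    using Hodge_eigenfunction_zero[OF \<eta> c l] eq by (simp add: coboundary_zero)
qed (use l(1) in \<open>auto simp: finite_cochain_l2 boundary_finite coboundary_finite finite_cochain_cochain
    laplacian_plus_linear laplacian_plus_symmetric[symmetric] laplacian_plus_nonneg\<close>)

lemma minus_operator: "nonneg_symmetric_operator S m (\<lambda>\<omega>. \<delta> (bd \<omega>)) l"
proof
  fix \<eta>
  assume \<eta>: "\<eta> \<in> \<H>" and weak: "\<And>\<omega>. \<omega> \<in> Fin \<Longrightarrow> ip (\<delta> (bd \<omega>)) \<eta> = - l * ip \<omega> \<eta>"
  then have \<eta>C: "\<eta> \<in> C" by (simp add: l2_cochains_def)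
  have eq: "\<delta> (bd \<eta>) \<tau> = - l * \<eta> \<tau>" if "\<tau> \<in> S" for \<tau>
    using weak laplacian_minus_symmetric that by (rule weak_eigenfunction)
  have "\<delta> (bd \<eta>) = (\<lambda>\<tau>. - l * \<eta> \<tau> + 0 * \<eta> \<tau>)"
  proof
    show "\<delta> (bd \<eta>) \<tau> = - l * \<eta> \<tau> + 0 * \<eta> \<tau>" for \<tau>
      using eq \<eta>C coboundary_cochain[OF boundary_cochain, of \<eta>]
      by (cases "\<tau> \<in> S") (auto simp: cochains_def)
  qed
  then have "(\<lambda>\<sigma>. - l * \<delta> \<eta> \<sigma> + 0 * \<delta> \<eta> \<sigma>) = \<delta> (\<delta> (bd \<eta>))"
    by (simp only: coboundary_linear[OF \<eta>C \<eta>C])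
  then have "\<delta> \<eta> = (\<lambda>_. 0)"
    using l(1) by (simp add: coboundary_coboundary[OF boundary_cochain] fun_eq_iff)
  then show "\<eta> = (\<lambda>_. 0)"
    using Hodge_eigenfunction_zero[OF \<eta> c l] eq by (simp add: boundary_zero)
qed (use l(1) in \<open>auto simp: finite_cochain_l2 boundary_finite coboundary_finite
    laplacian_minus_linear laplacian_minus_symmetric[symmetric] laplacian_minus_nonneg\<close>)

lemma Hodge_operator: "nonneg_symmetric_operator S m (\<lambda>\<omega> \<sigma>. bd (\<delta> \<omega>) \<sigma> + \<delta> (bd \<omega>) \<sigma>) l"
proof
  have plus: "bd (\<delta> \<omega>) \<in> \<H>" and minus: "\<delta> (bd \<omega>) \<in> \<H>" if "\<omega> \<in> Fin" for \<omega>
    using that by (simp_all add: finite_cochain_l2 boundary_finite coboundary_finite)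
  have split: "ip (\<lambda>\<sigma>. bd (\<delta> \<omega>) \<sigma> + \<delta> (bd \<omega>) \<sigma>) \<eta> = ip (bd (\<delta> \<omega>)) \<eta> + ip (\<delta> (bd \<omega>)) \<eta>"
    if "\<omega> \<in> Fin" "\<eta> \<in> \<H>" for \<omega> \<eta>
    using ip_lincomb_left[OF plus[OF that(1)] minus[OF that(1)] that(2), of 1 1] by simp
  show "(\<lambda>\<sigma>. bd (\<delta> \<omega>) \<sigma> + \<delta> (bd \<omega>) \<sigma>) \<in> \<H>" if "\<omega> \<in> Fin" for \<omega>
    using l2_lincomb[OF plus[OF that] minus[OF that], of 1 1] by simp
  show "(\<lambda>\<sigma>. bd (\<delta> (\<lambda>\<sigma>. a * \<omega> \<sigma> + b * \<eta> \<sigma>)) \<sigma> + \<delta> (bd (\<lambda>\<sigma>. a * \<omega> \<sigma> + b * \<eta> \<sigma>)) \<sigma>)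
      = (\<lambda>\<sigma>. a * (bd (\<delta> \<omega>) \<sigma> + \<delta> (bd \<omega>) \<sigma>) + b * (bd (\<delta> \<eta>) \<sigma> + \<delta> (bd \<eta>) \<sigma>))"
    if "\<omega> \<in> Fin" "\<eta> \<in> Fin" for \<omega> \<eta> a b
    using that by (simp add: laplacian_plus_linear laplacian_minus_linear finite_cochain_cochain algebra_simps)
  have sym: "ip (\<lambda>\<sigma>. bd (\<delta> \<omega>) \<sigma> + \<delta> (bd \<omega>) \<sigma>) \<eta> = ip \<omega> (bd (\<delta> \<eta>)) + ip \<omega> (\<delta> (bd \<eta>))"
    if "\<omega> \<in> Fin" "\<eta> \<in> \<H>" for \<omega> \<eta>
    using that split laplacian_plus_symmetric laplacian_minus_symmetric by (simp add: l2_cochains_def)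
  show "ip (\<lambda>\<sigma>. bd (\<delta> \<omega>) \<sigma> + \<delta> (bd \<omega>) \<sigma>) \<eta> = ip \<omega> (\<lambda>\<sigma>. bd (\<delta> \<eta>) \<sigma> + \<delta> (bd \<eta>) \<sigma>)"
    if "\<omega> \<in> Fin" "\<eta> \<in> Fin" for \<omega> \<eta>
    unfolding sym[OF that(1) finite_cochain_l2[OF that(2)]] ip_commute[of \<omega>]
      split[OF that(2) finite_cochain_l2[OF that(1)]] ..
  show "0 \<le> ip (\<lambda>\<sigma>. bd (\<delta> \<omega>) \<sigma> + \<delta> (bd \<omega>) \<sigma>) \<omega>" if "\<omega> \<in> Fin" for \<omega>
    unfolding split[OF that finite_cochain_l2[OF that]]
    by (intro add_nonneg_nonneg laplacian_plus_nonneg laplacian_minus_nonneg that)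
  show "l > 0" by (rule l(1))
next
  fix \<eta>
  assume \<eta>: "\<eta> \<in> \<H>"
    and weak: "\<And>\<omega>. \<omega> \<in> Fin \<Longrightarrow> ip (\<lambda>\<sigma>. bd (\<delta> \<omega>) \<sigma> + \<delta> (bd \<omega>) \<sigma>) \<eta> = - l * ip \<omega> \<eta>"
  have \<eta>C: "\<eta> \<in> C" using \<eta> by (simp add: l2_cochains_def)
  show "\<eta> = (\<lambda>_. 0)"
  proof (rule Hodge_eigenfunction_zero[OF \<eta> c l])
    fix \<tau>
    assume \<tau>: "\<tau> \<in> S"
    note ind = indicator_finite_cochain[OF \<tau>]
    \<comment> \<open>The sum is split on the indicator, where both parts are finitely supported;
      the two parts for \<eta> are not known to be square summable.\<close>
    have "ip (\<lambda>\<sigma>. bd (\<delta> (indicator {\<tau>})) \<sigma> + \<delta> (bd (indicator {\<tau>})) \<sigma>) \<eta>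
        = ip (bd (\<delta> (indicator {\<tau>}))) \<eta> + ip (\<delta> (bd (indicator {\<tau>}))) \<eta>"
      using ip_lincomb_left[OF finite_cochain_l2 finite_cochain_l2 \<eta>, of _ _ 1 1] ind
      by (simp add: boundary_finite coboundary_finite)
    then have "m \<tau> * (bd (\<delta> \<eta>) \<tau> + \<delta> (bd \<eta>) \<tau>) = m \<tau> * (- l * \<eta> \<tau>)"
      unfolding weak[OF ind] laplacian_plus_symmetric[OF ind \<eta>C] laplacian_minus_symmetric[OF ind]
        ip_indicator[OF \<tau>] by (simp add: distrib_left mult.left_commute)
    then show "bd (\<delta> \<eta>) \<tau> + \<delta> (bd \<eta>) \<tau> = - l * \<eta> \<tau>"
      using weight_pos[OF \<tau>] unfolding mult_cancel_left by simp
  qed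
qed

end

end

theorem theorem4p9:
  fixes V :: "'v set" and K S :: "'v set set" and m :: "'v set \<Rightarrow> real"
    and \<delta> :: "('v set \<Rightarrow> real) \<Rightarrow> ('v set \<Rightarrow> real)"
  assumes "abstract_simplicial_complex V K"
    and "is_weight K m"
    and "S = effective_complex K m"
    and "coboundary_operator S \<delta>"
    and "locally_summable S m"
    and "uniformly_positive S m"
    and "bdd_below (forman_curvature S m ` S)"
  shows "l2_essentially_self_adjoint S m (laplacian_plus S m \<delta>) \<and>
         l2_essentially_self_adjoint S m (laplacian_minus S m \<delta>) \<and>
         l2_essentially_self_adjoint S m (laplacian_Hodge S m \<delta>)"
proof -
  have SK: "\<sigma> \<in> S \<Longrightarrow> \<sigma> \<in> K" and KS: "\<sigma> \<in> K \<Longrightarrow> \<sigma> \<noteq> {} \<Longrightarrow> \<sigma> \<in> S" for \<sigma>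
    using assms(3) by (auto simp: effective_complex_def split: if_splits)
  interpret locally_finite_complex S m \<delta>
  proof
    show "0 < m \<tau>" if "\<tau> \<in> S" for \<tau>
      using assms(2) SK[OF that] by (simp add: is_weight_def)
    show "finite \<sigma>" if "\<sigma> \<in> S" for \<sigma>
      using assms(1) SK[OF that] by (simp add: abstract_simplicial_complex_def)
    show "\<rho> \<in> S" if "\<sigma> \<in> S" "\<rho> \<subseteq> \<sigma>" "\<rho> \<noteq> {}" for \<sigma> \<rho>
      using assms(1) SK[OF that(1)] that(2,3) by (intro KS) (auto simp: abstract_simplicial_complex_def)
    show "finite (cofaces_above S \<tau>)" if "\<tau> \<in> S" for \<tau>
      by (rule finite_cofaces_above[OF assms(5,6) that])
    show "coboundary_operator S \<delta>"
      by (rule assms(4))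
  qed
  obtain c where c: "c > 0" "\<And>\<tau>. \<tau> \<in> S \<Longrightarrow> c \<le> m \<tau>"
    using uniformly_positive_bound[OF assms(6)] by blast
  obtain B where B: "\<And>\<tau>. \<tau> \<in> S \<Longrightarrow> B \<le> forman_curvature S m \<tau>"
    using assms(7) by (auto simp: bdd_below_def)
  \<comment> \<open>The absolute value gives \<open>l > 0\<close> for either sign of
    \<open>B\<close>, and the \<open>+ 1\<close> makes \<open>- l < B\<close> strict.\<close>
  define l where "l = \<bar>B\<bar> + 1"
  have l: "l > 0" by (simp add: l_def)
  have curv: "- l * m \<tau> < forman_c S m \<tau>" if "\<tau> \<in> S" for \<tau>
  proof -
    have "- l < forman_curvature S m \<tau>"
      using B[OF that] by (simp add: l_def)
    then show ?thesis
      using weight_pos[OF that] by (simp add: forman_curvature_def pos_less_divide_eq)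
  qed
  have "laplacian_Hodge S m \<delta> = operator_graph (finite_cochains S) (\<lambda>\<omega> \<sigma>. bd (\<delta> \<omega>) \<sigma> + \<delta> (bd \<omega>) \<sigma>)"
    unfolding laplacian_Hodge_def operator_graph_def
    using gauss_bonnet_square[OF assms(1-6)] finite_cochain_cochain by auto
  then show ?thesis
    unfolding laplacian_plus_def laplacian_minus_def
    using nonneg_symmetric_operator.essentially_self_adjoint[OF plus_operator[OF c l curv]]
      nonneg_symmetric_operator.essentially_self_adjoint[OF minus_operator[OF c l curv]]
      nonneg_symmetric_operator.essentially_self_adjoint[OF Hodge_operator[OF c l curv]]
    by simp
qed

end
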